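(* Let $G$ be a non-compact second countable locally compact group, let $S\subset G$ be a subset that generates an abelian subgroup of $G$, and let $\omega$ be an $S$-admissible weight on $G$. The following conditions are equivalent: (1) There is an $S$-dense vector in $L^p(G,\omega)$ for every $p$, $1\le p<\infty$. (2) There is an $S$-dense vector in $L^p(G,\omega)$ for some $p$, $1\le p<\infty$. (3) For every compact set $F\subset G$ and any given $\delta>0$, there exist $s\in S$ and a compact set $E\subset F$ such that $|F\setminus E|<\delta$ and $$\operatorname*{ess\,sup}_{sE\cup s^{-1}E}\omega<\delta.$$ (4) For some $p$, $1\le p<\infty$, the following holds: for every compact set $F\subset G$ and any given $\delta>0$, there exist $s\in S$ and a compact set $E\subset F$ such that $|F\setminus E|<\delta$ and $$\Big(\int_{sE\cup s^{-1}E}\omega^p\,d\mu\Big)^{1/p}<\delta.$$ (5) For every $p$, $1\le p<\infty$, the following holds: for every compact set $F\subset G$ and any given $\delta>0$, there exist $s\in S$ and a compact set $E\subset F$ such that $|F\setminus E|<\delta$ and $\big(\int_{sE\cup s^{-1}E}\omega^p\,d\mu\big)^{1/p}<\delta$.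
   Context: $G$ has a left Haar measure $\mu$; $|A|=\mu(A)$. A weight on $G$ is a measurable strictly positive function $\omega$; it is assumed locally $p$-summable for every $1\le p<\infty$, i.e. $\int_K\omega^p\,d\mu<\infty$ for every compact $K\subset G$ and every such $p$. $L^p(G,\omega)$ is the space of (classes of) complex-valued measurable functions $f$ on $G$ with $\|f\|_{p,\omega}=\big(\int_G|f\omega|^p\,d\mu\big)^{1/p}<\infty$. For $s\in G$, $(T_sf)(t)=f(s^{-1}t)$. A weight $\omega$ is $S$-admissible if $\operatorname{ess\,sup}_{t\in G}\omega(st)/\omega(t)<\infty$ for all $s\in S$; for each $p$ this quantity is the norm of $T_s$ on $L^p(G,\omega)$, so the condition does not depend on $p$ and means that all $T_s$, $s\in S$, are bounded. A vector $f\in L^p(G,\omega)$ is $S$-dense if $\{T_sf:s\in S\}$ is dense in $L^p(G,\omega)$. The essential supremum of $\omega$ over a null (or empty) set is taken to be $0$. *)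

theory Defs
  imports "HOL-Probability.Essential_Supremum"
begin

text \<open>
  A topological group is a type of class \<open>topological_group_add\<close>. This class extends \<open>group_add\<close>,
  which is \<^emph>\<open>not\<close> assumed commutative: \<open>s + t\<close> stands for the product \<open>st\<close>, \<open>- s\<close> for the inverse
  of \<open>s\<close>, and the order of the summands matters throughout.
\<close>

definition is_subgroup :: "'a::group_add set \<Rightarrow> bool" where
  "is_subgroup H \<longleftrightarrow> 0 \<in> H \<and> (\<forall>x\<in>H. \<forall>y\<in>H. x + y \<in> H) \<and> (\<forall>x\<in>H. - x \<in> H)"

definition generates_abelian_subgroup :: "'a::group_add set \<Rightarrow> bool" where
  "generates_abelian_subgroup S \<longleftrightarrow>
     (\<forall>x \<in> is_subgroup hull S. \<forall>y \<in> is_subgroup hull S. x + y = y + x)"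

definition ltranslate :: "'a::group_add \<Rightarrow> 'a set \<Rightarrow> 'a set" where
  "ltranslate s A = (\<lambda>t. s + t) ` A"

text \<open>A left Haar measure: a nonzero left-invariant Radon measure on the Borel sets.\<close>

definition left_haar_measure :: "'a::topological_group_add measure \<Rightarrow> bool" where
  "left_haar_measure \<mu> \<longleftrightarrow>
     sets \<mu> = sets borel \<and>
     emeasure \<mu> UNIV \<noteq> 0 \<and>
     (\<forall>K. compact K \<longrightarrow> emeasure \<mu> K < \<infinity>) \<and>
     (\<forall>A\<in>sets borel. emeasure \<mu> A = (INF U\<in>{U. open U \<and> A \<subseteq> U}. emeasure \<mu> U)) \<and>
     (\<forall>U. open U \<longrightarrow> emeasure \<mu> U = (SUP K\<in>{K. compact K \<and> K \<subseteq> U}. emeasure \<mu> K)) \<and>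
     (\<forall>s. \<forall>A\<in>sets borel. emeasure \<mu> (ltranslate s A) = emeasure \<mu> A)"

definition weight :: "'a::topological_space measure \<Rightarrow> ('a \<Rightarrow> real) \<Rightarrow> bool" where
  "weight \<mu> \<omega> \<longleftrightarrow>
     \<omega> \<in> borel_measurable \<mu> \<and>
     (\<forall>t. 0 < \<omega> t) \<and>
     (\<forall>p\<ge>1. \<forall>K. compact K \<longrightarrow> (\<integral>\<^sup>+t\<in>K. ennreal (\<omega> t powr p) \<partial>\<mu>) < \<infinity>)"

definition admissible_weight ::
  "'a::topological_group_add measure \<Rightarrow> 'a set \<Rightarrow> ('a \<Rightarrow> real) \<Rightarrow> bool" where
  "admissible_weight \<mu> S \<omega> \<longleftrightarrow>
     weight \<mu> \<omega> \<and> (\<forall>s\<in>S. esssup \<mu> (\<lambda>t. ennreal (\<omega> (s + t) / \<omega> t)) < \<infinity>)"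

text \<open>Values in \<open>ennreal\<close> make the essential supremum over a null or empty set equal to \<open>0\<close>.\<close>

definition esssup_on :: "'a measure \<Rightarrow> 'a set \<Rightarrow> ('a \<Rightarrow> real) \<Rightarrow> ennreal" where
  "esssup_on \<mu> A \<omega> = esssup (restrict_space \<mu> A) (\<lambda>t. ennreal (\<omega> t))"

text \<open>The power \<open>x\<^sup>1\<^sup>/\<^sup>p\<close> of an extended nonnegative real.\<close>

definition ennreal_root :: "real \<Rightarrow> ennreal \<Rightarrow> ennreal" where
  "ennreal_root p x = (if x = \<infinity> then \<infinity> else ennreal (enn2real x powr (1 / p)))"

definition wLp_norm ::
  "'a measure \<Rightarrow> ('a \<Rightarrow> real) \<Rightarrow> real \<Rightarrow> ('a \<Rightarrow> complex) \<Rightarrow> ennreal" where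
  "wLp_norm \<mu> \<omega> p f =
     ennreal_root p (\<integral>\<^sup>+t. ennreal (cmod (f t * complex_of_real (\<omega> t)) powr p) \<partial>\<mu>)"

text \<open>Elements of the space are represented by functions rather than by classes modulo equality
  almost everywhere. Density of a set of vectors, expressed through \<open>wLp_norm\<close>, does not depend on
  the chosen representatives.\<close>

definition wLp :: "'a measure \<Rightarrow> ('a \<Rightarrow> real) \<Rightarrow> real \<Rightarrow> ('a \<Rightarrow> complex) set" where
  "wLp \<mu> \<omega> p = {f \<in> borel_measurable \<mu>. wLp_norm \<mu> \<omega> p f < \<infinity>}"

definition translation :: "'a::group_add \<Rightarrow> ('a \<Rightarrow> complex) \<Rightarrow> 'a \<Rightarrow> complex" where
  "translation s f = (\<lambda>t. f (- s + t))"

definition dense_vector ::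
  "'a::group_add measure \<Rightarrow> 'a set \<Rightarrow> ('a \<Rightarrow> real) \<Rightarrow> real \<Rightarrow> ('a \<Rightarrow> complex) \<Rightarrow> bool" where
  "dense_vector \<mu> S \<omega> p f \<longleftrightarrow>
     f \<in> wLp \<mu> \<omega> p \<and>
     (\<forall>g\<in>wLp \<mu> \<omega> p. \<forall>\<epsilon>>0. \<exists>s\<in>S.
        wLp_norm \<mu> \<omega> p (\<lambda>t. translation s f t - g t) < ennreal \<epsilon>)"

definition esssup_condition ::
  "'a::topological_group_add measure \<Rightarrow> 'a set \<Rightarrow> ('a \<Rightarrow> real) \<Rightarrow> bool" where
  "esssup_condition \<mu> S \<omega> \<longleftrightarrow>
     (\<forall>F. compact F \<longrightarrow> (\<forall>\<delta>>0. \<exists>s\<in>S. \<exists>E. compact E \<and> E \<subseteq> F \<and>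
        emeasure \<mu> (F - E) < ennreal \<delta> \<and>
        esssup_on \<mu> (ltranslate s E \<union> ltranslate (- s) E) \<omega> < ennreal \<delta>))"

definition Lp_condition ::
  "'a::topological_group_add measure \<Rightarrow> 'a set \<Rightarrow> ('a \<Rightarrow> real) \<Rightarrow> real \<Rightarrow> bool" where
  "Lp_condition \<mu> S \<omega> p \<longleftrightarrow>
     (\<forall>F. compact F \<longrightarrow> (\<forall>\<delta>>0. \<exists>s\<in>S. \<exists>E. compact E \<and> E \<subseteq> F \<and>
        emeasure \<mu> (F - E) < ennreal \<delta> \<and>
        ennreal_root p (\<integral>\<^sup>+t\<in>ltranslate s E \<union> ltranslate (- s) E. ennreal (\<omega> t powr p) \<partial>\<mu>)
          < ennreal \<delta>))"

end

theory Submission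
  imports Defs
begin

text \<open>
  Fix \<open>p \<ge> 1\<close>. It suffices to see that a dense vector exists in \<open>L\<^sup>p(G,\<omega>)\<close> if and only if the integral condition
  holds for \<open>p\<close>, and that the latter is equivalent to the essential supremum condition: as this does
  not mention \<open>p\<close>, all five statements are then equivalent.

  \<^bold>\<open>The two smallness conditions.\<close> Left invariance bounds the measure of \<open>sE \<union> s\<^sup>-\<^sup>1E\<close> by \<open>2\<bar>F\<bar>\<close>, so a small
  supremum gives a small integral. Conversely Chebyshev's inequality confines the large values of the
  weight to a small set, which is cut out of \<open>E\<close>
  (\<open>esssup_condition_imp_Lp_condition\<close>, \<open>Lp_condition_imp_esssup_condition\<close>).

  \<^bold>\<open>Necessity.\<close> Some \<open>f\<^sub>1 = T\<^sub>r f\<close> in the orbit of a dense vector \<open>f\<close> is close to the indicator \<open>1\<^sub>F\<close>. Because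
  translations by elements of \<open>S\<close> commute, a translate \<open>T\<^sub>s f\<^sub>1\<close> is close to \<open>3 \<cdot> 1\<^sub>F\<close>. Moving the values on \<open>F\<close> of
  these two functions by \<open>s\<close> and \<open>s\<^sup>-\<^sup>1\<close> shows that \<open>T\<^sub>s f\<^sub>1\<close> is near \<open>1\<close> on most of \<open>sF\<close> and \<open>f\<^sub>1\<close> is near \<open>3\<close> on most of
  \<open>s\<^sup>-\<^sup>1F\<close>; both contradict the approximations unless the weight has little mass there
  (\<open>dense_vector_imp_Lp_condition\<close>).

  \<^bold>\<open>Sufficiency.\<close> For bounded \<open>f\<close>, \<open>g\<close> with support in a compact \<open>F\<close>, the function \<open>f 1\<^sub>E + T\<^sub>s\<^sup>-\<^sup>1(g 1\<^sub>E)\<close> is close to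
  \<open>f\<close> and its image under \<open>T\<^sub>s\<close> is close to \<open>g\<close> (\<open>topologically_transitive\<close>). So the translations act
  topologically transitively on a separable complete space, and Baire's theorem yields a dense vector. The
  category argument is written out as a rapidly converging series (\<open>dense_vector_of_Lp_condition\<close>), which
  avoids passing to classes of functions; its ingredients are a countable dense set of test functions
  (\<open>countable_dense_test_functions\<close>) and an estimate for series (\<open>modular_suminf_le\<close>).

  Throughout, the \<open>p\<close>-th power of the norm, called the modular, takes the place of the norm. It satisfies the
  triangle inequality up to the factor \<open>2\<^sup>p\<close> only, which is harmless because series can be made to converge
  fast enough to absorb the powers of this factor.
\<close>

section \<open>Powers and roots\<close>

text \<open>
  The factor \<open>2\<^sup>p\<close> is cruder than convexity gives, but it is enough: the triangle inequality is only
  ever applied to two summands at a time.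
\<close>

lemma powr_add_le:
  fixes a b p :: real
  assumes "0 \<le> a" "0 \<le> b" "0 \<le> p"
  shows "(a + b) powr p \<le> 2 powr p * (a powr p + b powr p)"
proof -
  have "(a + b) powr p \<le> (2 * max a b) powr p"
    using assms by (intro powr_mono2) auto
  also have "\<dots> = 2 powr p * max a b powr p"
    using assms by (simp add: powr_mult)
  also have "\<dots> \<le> 2 powr p * (a powr p + b powr p)"
    by (intro mult_left_mono) (auto simp: max_def)
  finally show ?thesis .
qed

text \<open>
  The pointwise core of completeness. If the series of weighted powers has sum \<open>m\<close>, each of its terms is at most \<open>m\<close>,
  so \<open>\<bar>x k\<bar> \<le> m\<^sup>1\<^sup>/\<^sup>p / 2\<^sup>k\<^sup>+\<^sup>1\<close>, and these bounds add up to exactly \<open>m\<^sup>1\<^sup>/\<^sup>p\<close>. The weights \<open>2\<^sup>k\<^sup>+\<^sup>1\<close> thus replace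
  Minkowski's inequality for infinitely many summands; they cost nothing when the terms decrease fast.
\<close>

lemma summable_and_bound_of_weighted_powr:
  fixes x :: "nat \<Rightarrow> complex" and p :: real
  assumes p: "0 < p"
    and fin: "(\<Sum>k. ennreal ((2 ^ Suc k * cmod (x k)) powr p)) < \<infinity>" (is "?M < _")
  shows "summable x" and "ennreal (cmod (\<Sum>k. x k) powr p) \<le> ?M"
proof -
  define m where "m = enn2real ?M"
  have m: "0 \<le> m" "?M = ennreal m"
    unfolding m_def by (rule enn2real_nonneg)
      (rule ennreal_enn2real[OF fin[unfolded infinity_ennreal_def], symmetric])
  have x_le: "cmod (x k) \<le> m powr (1/p) * (1/2) ^ Suc k" for k
  proof -
    define h where "h k = (2 ^ Suc k * cmod (x k)) powr p" for k
    have "ennreal (h k) \<le> (\<Sum>k. ennreal (h k))"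
      using sum_le_suminf[OF summableI, of "{k}" "\<lambda>k. ennreal (h k)"] by simp
    then have "ennreal ((2 ^ Suc k * cmod (x k)) powr p) \<le> ennreal m"
      using m(2) by (simp only: h_def)
    then have "(2 ^ Suc k * cmod (x k)) powr p \<le> m"
      using m(1) by (simp only: ennreal_le_iff)
    then have "((2 ^ Suc k * cmod (x k)) powr p) powr (1/p) \<le> m powr (1/p)"
      using p by (intro powr_mono2) auto
    then have "2 ^ Suc k * cmod (x k) \<le> m powr (1/p)"
      using p by (simp add: powr_powr del: power_Suc)
    then show ?thesis
      by (simp add: field_simps)
  qed
  have geo: "(\<lambda>k. m powr (1/p) * (1/2) ^ Suc k) sums m powr (1/p)"
    using sums_mult[OF power_half_series] by simp
  have sn: "summable (\<lambda>k. cmod (x k))"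
    by (rule summable_comparison_test'[OF sums_summable[OF geo], of 0]) (use x_le in simp)
  then show "summable x"
    by (rule summable_norm_cancel)
  have "cmod (\<Sum>k. x k) \<le> (\<Sum>k. cmod (x k))"
    by (rule summable_norm[OF sn])
  also have "\<dots> \<le> m powr (1/p)"
    using suminf_le[OF x_le sn sums_summable[OF geo]] geo by (simp add: sums_iff)
  finally have "cmod (\<Sum>k. x k) powr p \<le> (m powr (1/p)) powr p"
    using p by (intro powr_mono2) auto
  then show "ennreal (cmod (\<Sum>k. x k) powr p) \<le> ?M"
    unfolding m(2) using p m(1) by (intro ennreal_leI) (simp add: powr_powr)
qed

lemma ennreal_root_less_iff:
  assumes "0 < p" "0 < \<epsilon>"
  shows "ennreal_root p x < ennreal \<epsilon> \<longleftrightarrow> x < ennreal (\<epsilon> powr p)"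
proof (cases x)
  case (real r)
  have "r powr (1/p) < \<epsilon> \<longleftrightarrow> r < \<epsilon> powr p"
  proof
    assume "r powr (1/p) < \<epsilon>"
    then have "(r powr (1/p)) powr p < \<epsilon> powr p"
      using assms by (intro powr_less_mono2) auto
    then show "r < \<epsilon> powr p" using assms real by (simp add: powr_powr)
  next
    assume "r < \<epsilon> powr p"
    then have "r powr (1/p) < (\<epsilon> powr p) powr (1/p)"
      using assms real by (intro powr_less_mono2) auto
    then show "r powr (1/p) < \<epsilon>" using assms real by (simp add: powr_powr)
  qed
  then show ?thesis
    using assms real by (simp add: ennreal_root_def ennreal_less_iff)
qed (simp add: ennreal_root_def)

lemma ennreal_root_less_top_iff: "ennreal_root p x < \<infinity> \<longleftrightarrow> x < \<infinity>"
  by (simp add: ennreal_root_def less_top)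

section \<open>Haar measure and its regularity\<close>

lemma mem_ltranslate_iff: "t \<in> ltranslate s A \<longleftrightarrow> - s + t \<in> A" for s t :: "'a::group_add"
proof
  assume "- s + t \<in> A"
  then show "t \<in> ltranslate s A"
    unfolding ltranslate_def by (intro image_eqI[where x = "- s + t"]) (simp_all add: add.assoc[symmetric])
qed (auto simp: ltranslate_def add.assoc[symmetric])

lemma compact_ltranslate:
  fixes s :: "'a::topological_group_add"
  assumes "compact A" shows "compact (ltranslate s A)"
  unfolding ltranslate_def
  by (rule compact_continuous_image[OF _ assms]) (intro continuous_intros)

locale weighted_haar_group =
  fixes \<mu> :: "'a::{topological_group_add, second_countable_topology, t2_space} measure"
    and \<omega> :: "'a \<Rightarrow> real" and p :: real
  assumes locally_compact: "locally compact (UNIV :: 'a set)"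
    and haar: "left_haar_measure \<mu>"
    and weight: "weight \<mu> \<omega>"
    and p_ge_1: "1 \<le> p"
begin

lemma p_pos: "0 < p"
  using p_ge_1 by simp

lemma sets_mu [measurable_cong]: "sets \<mu> = sets borel"
  using haar by (simp add: left_haar_measure_def)

lemma space_mu [simp]: "space \<mu> = UNIV"
  using sets_eq_imp_space_eq[OF sets_mu] by simp

lemma measurable_weight [measurable]: "\<omega> \<in> borel_measurable borel"
  using weight measurable_cong_sets[OF sets_mu refl] by (auto simp: weight_def)

lemma weight_pos: "0 < \<omega> t"
  using weight by (simp add: weight_def)

lemma measurable_left_add [measurable]: "(\<lambda>t. s + t) \<in> borel_measurable (borel :: 'a measure)"
  by (intro borel_measurable_continuous_onI continuous_intros)

lemma emeasure_compact: "compact K \<Longrightarrow> emeasure \<mu> K < \<infinity>"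
  using haar by (simp add: left_haar_measure_def)

lemma borel_compact: "compact K \<Longrightarrow> K \<in> sets borel" for K :: "'a set"
  by (simp add: compact_imp_closed borel_closed)

lemma emeasure_ltranslate: "A \<in> sets borel \<Longrightarrow> emeasure \<mu> (ltranslate s A) = emeasure \<mu> A"
  using haar by (simp add: left_haar_measure_def)

lemma borel_ltranslate: "ltranslate s A \<in> sets borel" if [measurable]: "A \<in> sets borel" for A :: "'a set"
proof -
  have "{t. - s + t \<in> A} \<in> sets borel"
    by measurable
  moreover have "ltranslate s A = {t. - s + t \<in> A}"
    using mem_ltranslate_iff by blast
  ultimately show ?thesis
    by simp
qed

lemma nn_integral_left_add:
  assumes f: "f \<in> borel_measurable borel"
  shows "(\<integral>\<^sup>+t. f (s + t) \<partial>\<mu>) = (\<integral>\<^sup>+t. f t \<partial>\<mu>)"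
proof -
  have [measurable]: "(\<lambda>t. s + t) \<in> measurable \<mu> \<mu>"
    using measurable_left_add measurable_cong_sets[OF sets_mu sets_mu] by blast
  have "distr \<mu> \<mu> (\<lambda>t. s + t) = \<mu>"
  proof (rule measure_eqI)
    fix A assume "A \<in> sets (distr \<mu> \<mu> (\<lambda>t. s + t))"
    then have A: "A \<in> sets \<mu>" by simp
    have "(\<lambda>t. s + t) -` A = ltranslate (- s) A"
      by (auto simp: mem_ltranslate_iff)
    then show "emeasure (distr \<mu> \<mu> (\<lambda>t. s + t)) A = emeasure \<mu> A"
      using A emeasure_ltranslate[of A "- s"] by (simp add: emeasure_distr sets_mu)
  qed simp
  moreover have "f \<in> borel_measurable \<mu>"
    using f measurable_cong_sets[OF sets_mu refl] by blast
  ultimately show ?thesis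
    using nn_integral_distr[of "\<lambda>t. s + t" \<mu> \<mu> f] by simp
qed

lemma outer_approximation:
  assumes A: "A \<in> sets borel" "emeasure \<mu> A < \<infinity>" and "0 < (\<epsilon>::ennreal)"
  obtains U where "open U" "A \<subseteq> U" "emeasure \<mu> U < \<infinity>" "emeasure \<mu> (U - A) < \<epsilon>"
proof -
  have "emeasure \<mu> A = (INF U\<in>{U. open U \<and> A \<subseteq> U}. emeasure \<mu> U)"
    using haar A by (simp add: left_haar_measure_def)
  moreover have "emeasure \<mu> A < emeasure \<mu> A + \<epsilon>"
    using assms by (simp add: ennreal_add_left_cancel_less less_top)
  ultimately have "(INF U\<in>{U. open U \<and> A \<subseteq> U}. emeasure \<mu> U) < emeasure \<mu> A + min \<epsilon> 1"
    using assms by (simp add: ennreal_add_left_cancel_less less_top)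
  then obtain U where U: "open U" "A \<subseteq> U" "emeasure \<mu> U < emeasure \<mu> A + min \<epsilon> 1"
    by (auto simp: INF_less_iff)
  have fin: "emeasure \<mu> U < \<infinity>"
  proof -
    have "emeasure \<mu> A + min \<epsilon> 1 \<le> emeasure \<mu> A + 1"
      by (intro add_left_mono) simp
    also have "\<dots> < \<infinity>" using A(2) by simp
    finally show ?thesis using U(3) by (rule less_trans[rotated])
  qed
  have Ub: "U \<in> sets \<mu>" using U sets_mu by auto
  have "emeasure \<mu> U = emeasure \<mu> A + emeasure \<mu> (U - A)"
    using U Ub A sets_mu by (subst plus_emeasure) (auto intro!: arg_cong[where f="emeasure \<mu>"])
  then have "emeasure \<mu> (U - A) < \<epsilon>"
    using U(3) A(2) by (auto simp: ennreal_add_left_cancel_less)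
  then show ?thesis
    using that U fin by blast
qed

text \<open>
  A Haar measure is by definition outer regular on Borel sets but inner regular only on open sets. Inside
  a compact \<open>F\<close>, inner approximation of \<open>A\<close> is outer approximation of \<open>F - A\<close>: if \<open>U\<close> is open and slightly
  larger than \<open>F - A\<close>, then \<open>F - U\<close> is compact and slightly smaller than \<open>A\<close>.
\<close>

lemma inner_approximation:
  assumes F: "compact F" and A: "A \<in> sets borel" "A \<subseteq> F" and \<epsilon>: "0 < (\<epsilon>::ennreal)"
  obtains E where "compact E" "E \<subseteq> A" "emeasure \<mu> (A - E) < \<epsilon>"
proof -
  have Fb: "F \<in> sets borel" using borel_compact F .
  have "emeasure \<mu> (F - A) \<le> emeasure \<mu> F"
    using Fb sets_mu by (intro emeasure_mono) auto
  then have "emeasure \<mu> (F - A) < \<infinity>"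
    using emeasure_compact[OF F] by (simp add: order_le_less_trans)
  with Fb A(1) \<epsilon> obtain U where U: "open U" "F - A \<subseteq> U" "emeasure \<mu> (U - (F - A)) < \<epsilon>"
    by (meson outer_approximation sets.Diff)
  have "A - (F - U) \<subseteq> U - (F - A)" using A(2) by blast
  then have "emeasure \<mu> (A - (F - U)) \<le> emeasure \<mu> (U - (F - A))"
    using U(1) Fb A(1) by (intro emeasure_mono) (simp_all add: sets_mu sets.Diff borel_open)
  moreover have "compact (F - U)" using F U by (simp add: compact_diff)
  moreover have "F - U \<subseteq> A" using U(2) by blast
  ultimately show ?thesis
    using that U(3) order_le_less_trans by metis
qed

section \<open>The modular of a weighted Lebesgue space\<close>

text \<open>
  The \<open>p\<close>-th power of the norm of \<open>L\<^sup>p(G,\<omega>)\<close>. Smallness of the norm and of the modular are the same thing,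
  and without the root there is no need for Minkowski's inequality.
\<close>

definition modular :: "('a \<Rightarrow> complex) \<Rightarrow> ennreal" where
  "modular h = (\<integral>\<^sup>+t. ennreal (cmod (h t * complex_of_real (\<omega> t)) powr p) \<partial>\<mu>)"

text \<open>
  On indicator functions the modular is the measure with density \<open>\<omega>\<^sup>p\<close> with respect to \<open>\<mu>\<close>.
\<close>

definition mass :: "'a set \<Rightarrow> ennreal" where
  "mass A = (\<integral>\<^sup>+t\<in>A. ennreal (\<omega> t powr p) \<partial>\<mu>)"

lemma cmod_weight [simp]: "cmod (z * complex_of_real (\<omega> t)) = cmod z * \<omega> t"
  using weight_pos[of t] by (simp add: norm_mult)

lemma modular_mono_AE:
  assumes "AE t in \<mu>. cmod (f t) \<le> cmod (g t)"
  shows "modular f \<le> modular g"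
  unfolding modular_def
proof (rule nn_integral_mono_AE, use assms in eventually_elim)
  case (elim t)
  then show ?case
    using p_ge_1 weight_pos[of t] by (auto intro!: ennreal_leI powr_mono2 mult_right_mono)
qed

lemma modular_cong_AE: "AE t in \<mu>. cmod (f t) = cmod (g t) \<Longrightarrow> modular f = modular g"
  by (intro antisym modular_mono_AE; elim eventually_mono; simp)

lemma modular_add_le:
  assumes [measurable]: "f \<in> borel_measurable borel" "g \<in> borel_measurable borel"
  shows "modular (\<lambda>t. f t + g t) \<le> ennreal (2 powr p) * (modular f + modular g)"
proof -
  have "modular (\<lambda>t. f t + g t) \<le>
      (\<integral>\<^sup>+t. ennreal (2 powr p) * (ennreal ((cmod (f t) * \<omega> t) powr p) + ennreal ((cmod (g t) * \<omega> t) powr p)) \<partial>\<mu>)"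
    unfolding modular_def
  proof (rule nn_integral_mono)
    fix t
    have "(cmod (f t + g t) * \<omega> t) powr p \<le> (cmod (f t) * \<omega> t + cmod (g t) * \<omega> t) powr p"
      using weight_pos[of t] p_ge_1 norm_triangle_ineq[of "f t" "g t"]
      by (intro powr_mono2) (auto simp flip: distrib_right)
    also have "\<dots> \<le> 2 powr p * ((cmod (f t) * \<omega> t) powr p + (cmod (g t) * \<omega> t) powr p)"
      using weight_pos[of t] p_ge_1 by (intro powr_add_le) auto
    finally show "ennreal (cmod ((f t + g t) * complex_of_real (\<omega> t)) powr p) \<le>
      ennreal (2 powr p) * (ennreal ((cmod (f t) * \<omega> t) powr p) + ennreal ((cmod (g t) * \<omega> t) powr p))"
      by (simp add: ennreal_leI flip: ennreal_plus ennreal_mult)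
  qed
  also have "\<dots> = ennreal (2 powr p) * (modular f + modular g)"
    unfolding modular_def cmod_weight
    by (subst nn_integral_cmult, measurable, subst nn_integral_add, measurable)
  finally show ?thesis .
qed

lemma modular_uminus: "modular (\<lambda>t. - f t) = modular f"
  by (rule modular_cong_AE) simp

lemma mass_mono: "A \<subseteq> B \<Longrightarrow> mass A \<le> mass B"
  unfolding mass_def by (intro nn_integral_mono) (auto simp: indicator_def)

lemma mass_Un_le:
  assumes [measurable]: "A \<in> sets borel" "B \<in> sets borel"
  shows "mass (A \<union> B) \<le> mass A + mass B"
proof -
  have "mass (A \<union> B) \<le> (\<integral>\<^sup>+t. ennreal (\<omega> t powr p) * indicator A t + ennreal (\<omega> t powr p) * indicator B t \<partial>\<mu>)"
    unfolding mass_def by (intro nn_integral_mono) (auto simp: indicator_def)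
  also have "\<dots> = mass A + mass B"
    unfolding mass_def by (subst nn_integral_add) measurable
  finally show ?thesis .
qed

lemma mass_compact: "compact K \<Longrightarrow> mass K < \<infinity>"
  using weight p_ge_1 unfolding mass_def weight_def by blast

text \<open>
  Chebyshev's inequality, in the form that turns closeness of two functions in \<open>L\<^sup>p(G,\<omega>)\<close> into smallness
  of the set on which they differ markedly.
\<close>

lemma mass_le_modular:
  assumes [measurable]: "A \<in> sets borel" and "0 < c" "\<And>t. t \<in> A \<Longrightarrow> c \<le> cmod (h t)"
  shows "ennreal (c powr p) * mass A \<le> modular h"
proof -
  have "ennreal (c powr p) * mass A = (\<integral>\<^sup>+t. ennreal (c powr p) * (ennreal (\<omega> t powr p) * indicator A t) \<partial>\<mu>)"
    unfolding mass_def by (rule nn_integral_cmult[symmetric]) measurable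
  also have "\<dots> \<le> modular h"
    unfolding modular_def
  proof (rule nn_integral_mono)
    fix t
    show "ennreal (c powr p) * (ennreal (\<omega> t powr p) * indicator A t) \<le>
      ennreal (cmod (h t * complex_of_real (\<omega> t)) powr p)"
    proof (cases "t \<in> A")
      case True
      then have "(c * \<omega> t) powr p \<le> (cmod (h t) * \<omega> t) powr p"
        using assms weight_pos[of t] p_ge_1 by (intro powr_mono2 mult_right_mono) auto
      then show ?thesis
        using True assms weight_pos[of t] by (simp add: ennreal_leI powr_mult flip: ennreal_mult)
    qed simp
  qed
  finally show ?thesis .
qed

lemma modular_le_mass:
  assumes [measurable]: "A \<in> sets borel"
    and "\<And>t. cmod (h t) \<le> C" "\<And>t. t \<notin> A \<Longrightarrow> h t = 0"
  shows "modular h \<le> ennreal (C powr p) * mass A"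
proof -
  have C: "0 \<le> C" using assms(2) norm_ge_zero order_trans by blast
  have "modular h \<le> (\<integral>\<^sup>+t. ennreal (C powr p) * (ennreal (\<omega> t powr p) * indicator A t) \<partial>\<mu>)"
    unfolding modular_def
  proof (rule nn_integral_mono)
    fix t
    have "(cmod (h t) * \<omega> t) powr p \<le> (C * \<omega> t) powr p"
      using assms(2)[of t] weight_pos[of t] p_ge_1 by (intro powr_mono2 mult_right_mono) auto
    then show "ennreal (cmod (h t * complex_of_real (\<omega> t)) powr p) \<le>
        ennreal (C powr p) * (ennreal (\<omega> t powr p) * indicator A t)"
      using assms(3)[of t] weight_pos[of t] C
      by (cases "t \<in> A") (simp_all add: ennreal_leI powr_mult flip: ennreal_mult)
  qed
  also have "\<dots> = ennreal (C powr p) * mass A"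
    unfolding mass_def by (rule nn_integral_cmult) measurable
  finally show ?thesis .
qed

section \<open>Comparison of Haar measure and weighted mass\<close>

text \<open>
  On a compact set the two measures \<open>\<mu>\<close> and \<open>\<omega>\<^sup>p \<mu>\<close> are finite and have the same null sets, so smallness
  for one is uniformly equivalent to smallness for the other; this lemma and the next are the two
  directions. Here \<open>\<omega>\<^sup>p\<close> is split at a high level: by dominated convergence the part of \<open>F\<close> where \<open>\<omega>\<close> exceeds
  \<open>n\<close> carries little mass, and on the rest mass is at most a constant times measure.
\<close>

lemma mass_small_of_measure_small:
  assumes F: "compact F" and \<epsilon>: "0 < (\<epsilon>::real)"
  obtains \<eta> :: real where "0 < \<eta>"
    "\<And>A. A \<in> sets borel \<Longrightarrow> A \<subseteq> F \<Longrightarrow> emeasure \<mu> A < ennreal \<eta> \<Longrightarrow> mass A < ennreal \<epsilon>"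
proof -
  have [measurable]: "F \<in> sets borel" using borel_compact F .
  let ?B = "\<lambda>n. {t \<in> F. real n < \<omega> t}"
  have "(\<lambda>n. mass (?B n)) \<longlonglongrightarrow> (\<integral>\<^sup>+t. 0 \<partial>\<mu>)"
    unfolding mass_def
  proof (rule nn_integral_dominated_convergence[where w = "\<lambda>t. ennreal (\<omega> t powr p) * indicator F t"])
    show "(\<integral>\<^sup>+t. ennreal (\<omega> t powr p) * indicator F t \<partial>\<mu>) < \<infinity>"
      using mass_compact[OF F] by (simp add: mass_def)
    show "AE t in \<mu>. (\<lambda>n. ennreal (\<omega> t powr p) * indicator (?B n) t) \<longlonglongrightarrow> 0"
    proof (rule AE_I2)
      fix t
      obtain m where m: "\<omega> t \<le> real m" using real_arch_simple by blast
      have "eventually (\<lambda>n. ennreal (\<omega> t powr p) * indicator (?B n) t = 0) sequentially"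
        using eventually_ge_at_top[of m]
      proof eventually_elim
        case (elim n)
        then have "t \<notin> ?B n" using m by force
        then show ?case by (simp del: mem_Collect_eq)
      qed
      then show "(\<lambda>n. ennreal (\<omega> t powr p) * indicator (?B n) t) \<longlonglongrightarrow> 0"
        by (rule tendsto_eventually)
    qed
  qed (measurable, auto simp: indicator_def)
  then have "eventually (\<lambda>n. mass (?B n) < ennreal (\<epsilon>/2)) sequentially"
    using \<epsilon> by (intro order_tendstoD(2)) auto
  then obtain n where n: "mass (?B n) < ennreal (\<epsilon>/2)"
    by (auto simp: eventually_sequentially)
  define M where "M = real (Suc n)"
  have M: "0 < M" by (simp add: M_def)
  show ?thesis
  proof (rule that[of "\<epsilon> / 2 / M powr p"])
    show "0 < \<epsilon> / 2 / M powr p" using \<epsilon> M by simp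
    fix A assume [measurable]: "A \<in> sets borel" and A: "A \<subseteq> F" "emeasure \<mu> A < ennreal (\<epsilon> / 2 / M powr p)"
    have "mass A \<le> mass (A \<inter> {t. \<omega> t \<le> real n} \<union> ?B n)"
      by (intro mass_mono) (use A in force)
    also have "\<dots> \<le> mass (A \<inter> {t. \<omega> t \<le> real n}) + mass (?B n)"
      by (intro mass_Un_le) measurable
    also have "mass (A \<inter> {t. \<omega> t \<le> real n}) \<le> (\<integral>\<^sup>+t. ennreal (M powr p) * indicator A t \<partial>\<mu>)"
      unfolding mass_def
      by (intro nn_integral_mono)
        (use weight_pos p_ge_1 in \<open>auto simp: indicator_def M_def less_imp_le intro!: ennreal_leI powr_mono2 add_increasing\<close>)
    also have "\<dots> = ennreal (M powr p) * emeasure \<mu> A"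
      by (rule nn_integral_cmult_indicator) (simp add: sets_mu)
    also have "\<dots> \<le> ennreal (M powr p) * ennreal (\<epsilon> / 2 / M powr p)"
      using A(2) by (intro mult_left_mono) auto
    also have "\<dots> = ennreal (\<epsilon> / 2)"
      using M \<epsilon> by (simp flip: ennreal_mult)
    also have "ennreal (\<epsilon>/2) + mass (?B n) < ennreal (\<epsilon>/2) + ennreal (\<epsilon>/2)"
      using n by (simp add: ennreal_add_left_cancel_less)
    also have "\<dots> = ennreal \<epsilon>" using \<epsilon> by (simp flip: ennreal_plus)
    finally show "mass A < ennreal \<epsilon>" by (simp add: add_right_mono)
  qed
qed

text \<open>
  Positivity of the weight enters: the sets where \<open>\<omega> < 1/(n+1)\<close> decrease to the empty set, and outside
  such a set measure is at most a constant times mass.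
\<close>

lemma measure_small_of_mass_small:
  assumes F: "compact F" and \<epsilon>: "0 < (\<epsilon>::real)"
  obtains \<eta> :: real where "0 < \<eta>"
    "\<And>A. A \<in> sets borel \<Longrightarrow> A \<subseteq> F \<Longrightarrow> mass A < ennreal \<eta> \<Longrightarrow> emeasure \<mu> A < ennreal \<epsilon>"
proof -
  have [measurable]: "F \<in> sets borel" using borel_compact F .
  let ?B = "\<lambda>n. {t \<in> F. \<omega> t < 1 / real (Suc n)}"
  have "(\<lambda>n. emeasure \<mu> (?B n)) \<longlonglongrightarrow> emeasure \<mu> (\<Inter>n. ?B n)"
  proof (rule Lim_emeasure_decseq)
    show "range ?B \<subseteq> sets \<mu>" by (auto simp: sets_mu)
    show "decseq ?B"
    proof (rule decseq_SucI)
      fix n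
      have "1 / real (Suc (Suc n)) \<le> 1 / real (Suc n)" by (simp add: field_simps)
      then show "?B (Suc n) \<subseteq> ?B n" by auto
    qed
    fix n
    have "emeasure \<mu> (?B n) \<le> emeasure \<mu> F"
      by (intro emeasure_mono) (auto simp: sets_mu)
    then show "emeasure \<mu> (?B n) \<noteq> \<infinity>"
      using emeasure_compact[OF F] by (auto simp: top_unique)
  qed
  also have "(\<Inter>n. ?B n) = {}"
  proof -
    have "\<exists>n. 1 / real (Suc n) \<le> \<omega> t" for t
      using nat_approx_posE[OF weight_pos[of t]] by (metis less_imp_le)
    then show ?thesis by (auto simp: not_less) (metis not_less)
  qed
  finally have "eventually (\<lambda>n. emeasure \<mu> (?B n) < ennreal (\<epsilon>/2)) sequentially"
    using \<epsilon> by (intro order_tendstoD(2)) auto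
  then obtain n where n: "emeasure \<mu> (?B n) < ennreal (\<epsilon>/2)"
    by (auto simp: eventually_sequentially)
  define c where "c = 1 / real (Suc n)"
  have c: "0 < c" by (simp add: c_def)
  show ?thesis
  proof (rule that[of "c powr p * (\<epsilon>/2)"])
    show "0 < c powr p * (\<epsilon>/2)" using c \<epsilon> by simp
    fix A assume [measurable]: "A \<in> sets borel" and A: "A \<subseteq> F" "mass A < ennreal (c powr p * (\<epsilon>/2))"
    let ?A = "{t \<in> A. c \<le> \<omega> t}"
    have "ennreal (c powr p) * emeasure \<mu> ?A = (\<integral>\<^sup>+t. ennreal (c powr p) * indicator ?A t \<partial>\<mu>)"
      by (rule nn_integral_cmult_indicator[symmetric]) (simp add: sets_mu)
    also have "\<dots> \<le> mass A"
      unfolding mass_def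
      by (intro nn_integral_mono)
        (use c p_ge_1 in \<open>auto simp: indicator_def intro!: ennreal_leI powr_mono2\<close>)
    also have "\<dots> < ennreal (c powr p * (\<epsilon>/2))"
      by (rule A(2))
    also have "\<dots> = ennreal (c powr p) * ennreal (\<epsilon>/2)"
      using \<epsilon> by (intro ennreal_mult) auto
    finally have *: "emeasure \<mu> ?A < ennreal (\<epsilon>/2)"
      by (meson leD leI mult_left_mono zero_le)
    have "emeasure \<mu> A \<le> emeasure \<mu> (?A \<union> ?B n)"
      by (intro emeasure_mono) (use A in \<open>auto simp: sets_mu c_def\<close>)
    also have "\<dots> \<le> emeasure \<mu> ?A + emeasure \<mu> (?B n)"
      by (intro emeasure_subadditive) (simp_all add: sets_mu)
    also have "\<dots> < ennreal (\<epsilon>/2) + ennreal (\<epsilon>/2)"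
      using * n by (rule add_strict_mono)
    also have "\<dots> = ennreal \<epsilon>" using \<epsilon> by (simp flip: ennreal_plus)
    finally show "emeasure \<mu> A < ennreal \<epsilon>" .
  qed
qed

section \<open>Equivalence of the integral and the essential supremum conditions\<close>

lemma Lp_condition_iff:
  "Lp_condition \<mu> S \<omega> p \<longleftrightarrow>
     (\<forall>F. compact F \<longrightarrow> (\<forall>\<delta>>0. \<exists>s\<in>S. \<exists>E. compact E \<and> E \<subseteq> F \<and>
        emeasure \<mu> (F - E) < ennreal \<delta> \<and>
        mass (ltranslate s E \<union> ltranslate (- s) E) < ennreal (\<delta> powr p)))"
  unfolding Lp_condition_def mass_def by (simp add: ennreal_root_less_iff p_pos cong: conj_cong)

lemma emeasure_less_of_subset_Un3:
  assumes "A \<in> sets borel" "B \<in> sets borel" "C \<in> sets borel" "D \<subseteq> A \<union> B \<union> C"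
    and "emeasure \<mu> A < ennreal \<delta>" "emeasure \<mu> B < ennreal \<delta>" "emeasure \<mu> C < ennreal \<delta>" "0 < \<delta>"
  shows "emeasure \<mu> D < ennreal (3 * \<delta>)"
proof -
  have "emeasure \<mu> D \<le> emeasure \<mu> (A \<union> B \<union> C)"
    using assms by (intro emeasure_mono) (auto simp: sets_mu)
  also have "\<dots> \<le> emeasure \<mu> (A \<union> B) + emeasure \<mu> C"
    using assms by (intro emeasure_subadditive) (auto simp: sets_mu)
  also have "\<dots> \<le> emeasure \<mu> A + emeasure \<mu> B + emeasure \<mu> C"
    using assms by (intro add_right_mono emeasure_subadditive) (auto simp: sets_mu)
  also have "\<dots> < ennreal \<delta> + ennreal \<delta> + ennreal \<delta>"
    using assms by (intro add_strict_mono) auto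
  also have "\<dots> = ennreal (3 * \<delta>)"
    using assms by (simp flip: ennreal_plus)
  finally show ?thesis .
qed

lemma esssup_on_le:
  assumes "A \<in> sets borel" "\<And>t. t \<in> A \<Longrightarrow> \<omega> t \<le> c"
  shows "esssup_on \<mu> A \<omega> \<le> ennreal c"
  unfolding esssup_on_def
proof (rule esssup_I)
  show "(\<lambda>t. ennreal (\<omega> t)) \<in> borel_measurable (restrict_space \<mu> A)"
    by (rule measurable_restrict_space1) measurable
  show "AE t in restrict_space \<mu> A. ennreal (\<omega> t) \<le> ennreal c"
    using assms by (intro AE_I2) (auto simp: space_restrict_space intro!: ennreal_leI)
qed

lemma mass_le_of_esssup_on_less:
  assumes [measurable]: "A \<in> sets borel" and c: "esssup_on \<mu> A \<omega> < ennreal c"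
  shows "mass A \<le> ennreal (c powr p) * emeasure \<mu> A"
proof -
  have "AE t in restrict_space \<mu> A. ennreal (\<omega> t) \<le> esssup_on \<mu> A \<omega>"
    unfolding esssup_on_def by (rule esssup_AE)
  then have "AE t in restrict_space \<mu> A. ennreal (\<omega> t) \<le> ennreal c"
    by eventually_elim (use c in auto)
  then have "AE t in \<mu>. t \<in> A \<longrightarrow> ennreal (\<omega> t) \<le> ennreal c"
    by (subst (asm) AE_restrict_space_iff) (simp_all add: sets_mu)
  then have "mass A \<le> (\<integral>\<^sup>+t. ennreal (c powr p) * indicator A t \<partial>\<mu>)"
    unfolding mass_def
  proof (intro nn_integral_mono_AE, eventually_elim)
    case (elim t)
    show ?case
    proof (cases "t \<in> A")
      case True
      then have "\<omega> t \<le> c" using elim weight_pos[of t] by (simp add: ennreal_le_iff2)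
      then show ?thesis
        using True weight_pos[of t] p_ge_1 by (auto intro!: ennreal_leI powr_mono2)
    qed simp
  qed
  also have "\<dots> = ennreal (c powr p) * emeasure \<mu> A"
    by (rule nn_integral_cmult_indicator) (simp add: sets_mu)
  finally show ?thesis .
qed

lemma borel_compact_translates:
  fixes E :: "'a set"
  assumes "compact E"
  shows "ltranslate s E \<in> sets borel" "ltranslate s E \<union> ltranslate (- s) E \<in> sets borel"
  using borel_ltranslate[OF borel_compact[OF assms]] by auto

text \<open>
  By left invariance \<open>sE \<union> s\<^sup>-\<^sup>1E\<close> has measure at most \<open>2\<bar>F\<bar>\<close>, whatever \<open>s\<close> is. A uniformly small weight on
  a set of bounded measure has a small integral.
\<close>

lemma esssup_condition_imp_Lp_condition:
  assumes "esssup_condition \<mu> S \<omega>"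
  shows "Lp_condition \<mu> S \<omega> p"
  unfolding Lp_condition_iff
proof (intro allI impI)
  fix F :: "'a set" and \<delta> :: real
  assume F: "compact F" and \<delta>: "0 < \<delta>"
  obtain m where m: "0 \<le> m" "emeasure \<mu> F = ennreal m"
    using emeasure_compact[OF F] by (cases "emeasure \<mu> F") auto
  \<comment> \<open>The summand \<open>1\<close> makes the final estimate strict: \<open>(\<delta>/k)\<^sup>p 2m < (\<delta>/k)\<^sup>p k \<le> \<delta>\<^sup>p\<close>, as \<open>k \<le> k\<^sup>p\<close>.\<close>
  define k where "k = 2 * m + 1"
  have k: "1 \<le> k" using m by (simp add: k_def)
  define c where "c = \<delta> / k"
  have c: "0 < c" "c \<le> \<delta>"
    using \<delta> k by (auto simp: c_def field_simps)
  obtain s E where s: "s \<in> S" and E: "compact E" "E \<subseteq> F" "emeasure \<mu> (F - E) < ennreal c"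
    and sup: "esssup_on \<mu> (ltranslate s E \<union> ltranslate (- s) E) \<omega> < ennreal c"
    using assms F c(1) unfolding esssup_condition_def by meson
  let ?A = "ltranslate s E \<union> ltranslate (- s) E"
  have Eb: "E \<in> sets borel" by (rule borel_compact[OF E(1)])
  have "emeasure \<mu> E \<le> ennreal m"
    unfolding m(2)[symmetric] using E borel_compact[OF F] by (intro emeasure_mono) (auto simp: sets_mu)
  then have A: "emeasure \<mu> ?A \<le> ennreal m + ennreal m"
    using emeasure_subadditive[of "ltranslate s E" \<mu> "ltranslate (- s) E"] borel_ltranslate[OF Eb]
      emeasure_ltranslate[OF Eb] by (auto simp: sets_mu intro: order_trans add_mono)
  have "mass ?A \<le> ennreal (c powr p) * emeasure \<mu> ?A"
    using borel_compact_translates[OF E(1)] sup by (intro mass_le_of_esssup_on_less) auto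
  also have "\<dots> \<le> ennreal (c powr p) * (ennreal m + ennreal m)"
    using A by (rule mult_left_mono) simp
  also have "\<dots> = ennreal (c powr p * (k - 1))"
    using m by (simp add: k_def flip: ennreal_plus ennreal_mult)
  also have "\<dots> < ennreal (\<delta> powr p)"
  proof (rule ennreal_lessI)
    have "c powr p * (k - 1) < c powr p * k"
      using c by simp
    also have "\<dots> \<le> c powr p * k powr p"
      using powr_mono[OF p_ge_1 k] k by (intro mult_left_mono) auto
    also have "\<dots> = \<delta> powr p"
      using k \<delta> by (simp add: c_def flip: powr_mult)
    finally show "c powr p * (k - 1) < \<delta> powr p" .
  qed (use \<delta> in simp)
  finally have "mass ?A < ennreal (\<delta> powr p)" .
  moreover have "emeasure \<mu> (F - E) < ennreal \<delta>"
    using E(3) c(2) by (meson ennreal_leI order_less_le_trans)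
  ultimately show "\<exists>s\<in>S. \<exists>E. compact E \<and> E \<subseteq> F \<and> emeasure \<mu> (F - E) < ennreal \<delta> \<and>
        mass (ltranslate s E \<union> ltranslate (- s) E) < ennreal (\<delta> powr p)"
    using s E by blast
qed

text \<open>
  By Chebyshev's inequality the part \<open>B\<close> of \<open>sE \<union> s\<^sup>-\<^sup>1E\<close> on which \<open>\<omega>\<close> is not small has small measure.
  Left invariance keeps it small when it is moved back to \<open>E\<close> by \<open>s\<close> and by \<open>s\<^sup>-\<^sup>1\<close>, so these two pieces
  can be cut out of \<open>E\<close>; inner regularity restores compactness.
\<close>

lemma Lp_condition_imp_esssup_condition:
  assumes "Lp_condition \<mu> S \<omega> p"
  shows "esssup_condition \<mu> S \<omega>"
  unfolding esssup_condition_def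
proof (intro allI impI)
  fix F :: "'a set" and \<delta> :: real
  assume F: "compact F" and \<delta>: "0 < \<delta>"
  define c where "c = \<delta> / 2"
  have c: "0 < c" "c < \<delta>" using \<delta> by (auto simp: c_def)
  \<comment> \<open>The second bound yields \<open>d\<^sup>p \<le> c\<^sup>p \<delta>/6\<close>, hence \<open>\<bar>B\<bar> < \<delta>/6\<close> for the set \<open>B\<close> where \<open>\<omega> \<ge> c\<close>.\<close>
  define d where "d = min (\<delta> / 3) (c * (\<delta> / 6) powr (1 / p))"
  have d: "0 < d" "d \<le> \<delta> / 3" "d \<le> c * (\<delta> / 6) powr (1 / p)"
    using \<delta> c by (auto simp: d_def)
  have "d powr p \<le> (c * (\<delta> / 6) powr (1 / p)) powr p"
    using d p_pos by (intro powr_mono2) auto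
  also have "\<dots> = c powr p * (\<delta> / 6)"
    using c \<delta> p_pos by (simp add: powr_mult powr_powr)
  finally have dp: "d powr p \<le> c powr p * (\<delta> / 6)" .
  obtain s E where s: "s \<in> S" and E: "compact E" "E \<subseteq> F" "emeasure \<mu> (F - E) < ennreal d"
    and mass: "mass (ltranslate s E \<union> ltranslate (- s) E) < ennreal (d powr p)"
    using assms[unfolded Lp_condition_iff] F d(1) by meson
  let ?A = "ltranslate s E \<union> ltranslate (- s) E"
  have [measurable]: "E \<in> sets borel" "F \<in> sets borel"
    using borel_compact E F by auto
  have [measurable]: "?A \<in> sets borel"
    using borel_compact_translates[OF E(1)] by simp
  define B where "B = {t \<in> ?A. c \<le> \<omega> t}"
  have [measurable]: "B \<in> sets borel" unfolding B_def by measurable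
  have "ennreal (c powr p) * emeasure \<mu> B = (\<integral>\<^sup>+t. ennreal (c powr p) * indicator B t \<partial>\<mu>)"
    by (rule nn_integral_cmult_indicator[symmetric]) (simp add: sets_mu)
  also have "\<dots> \<le> mass ?A"
    unfolding mass_def
    by (intro nn_integral_mono)
      (use c p_ge_1 in \<open>auto simp: indicator_def B_def intro!: ennreal_leI powr_mono2\<close>)
  also have "\<dots> < ennreal (c powr p * (\<delta> / 6))"
    using mass dp by (meson ennreal_leI order_less_le_trans)
  also have "\<dots> = ennreal (c powr p) * ennreal (\<delta> / 6)"
    using \<delta> by (intro ennreal_mult) auto
  finally have B: "emeasure \<mu> B < ennreal (\<delta> / 6)"
    by (meson leD leI mult_left_mono zero_le)
  define B' where "B' = ltranslate s B \<union> ltranslate (- s) B"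
  have [measurable]: "B' \<in> sets borel"
    unfolding B'_def using borel_ltranslate[of B] by auto
  have "emeasure \<mu> B' \<le> emeasure \<mu> (ltranslate s B) + emeasure \<mu> (ltranslate (- s) B)"
    unfolding B'_def using borel_ltranslate[of B] by (intro emeasure_subadditive) (auto simp: sets_mu)
  also have "\<dots> = emeasure \<mu> B + emeasure \<mu> B"
    by (simp add: emeasure_ltranslate)
  also have "\<dots> < ennreal (\<delta> / 6) + ennreal (\<delta> / 6)"
    using B by (intro add_strict_mono)
  also have "\<dots> = ennreal (\<delta> / 3)"
    using \<delta> by (simp flip: ennreal_plus)
  finally have B': "emeasure \<mu> B' < ennreal (\<delta> / 3)" .
  have "E - B' \<in> sets borel" "E - B' \<subseteq> F" "0 < ennreal (\<delta> / 3)"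
    using E \<delta> by auto
  then obtain K where K: "compact K" "K \<subseteq> E - B'" "emeasure \<mu> (E - B' - K) < ennreal (\<delta> / 3)"
    using inner_approximation[OF F] by metis
  have [measurable]: "K \<in> sets borel" using borel_compact K by auto
  have "emeasure \<mu> (F - E) < ennreal (\<delta> / 3)"
    using E(3) d(2) by (meson ennreal_leI order_less_le_trans)
  then have "emeasure \<mu> (F - K) < ennreal (3 * (\<delta> / 3))"
    using B' K(3) \<delta> by (intro emeasure_less_of_subset_Un3[of "F - E" B' "E - B' - K"]) auto
  then have FK: "emeasure \<mu> (F - K) < ennreal \<delta>" by simp
  have "\<omega> t \<le> c" if "t \<in> ltranslate s K \<union> ltranslate (- s) K" for t
  proof -
    have "t \<notin> B"
      using that K(2) by (auto simp: B'_def mem_ltranslate_iff add.assoc[symmetric])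
    moreover have "t \<in> ?A"
      using that K(2) by (auto simp: mem_ltranslate_iff)
    ultimately show ?thesis by (auto simp: B_def)
  qed
  then have "esssup_on \<mu> (ltranslate s K \<union> ltranslate (- s) K) \<omega> \<le> ennreal c"
    using borel_compact_translates[OF K(1)] by (intro esssup_on_le) auto
  also have "\<dots> < ennreal \<delta>"
    using c by (intro ennreal_lessI) auto
  finally show "\<exists>s\<in>S. \<exists>E. compact E \<and> E \<subseteq> F \<and> emeasure \<mu> (F - E) < ennreal \<delta> \<and>
        esssup_on \<mu> (ltranslate s E \<union> ltranslate (- s) E) \<omega> < ennreal \<delta>"
    using s K E(2) FK by blast
qed

section \<open>A dense vector forces small translates of the weight\<close>

lemma mem_wLp_iff: "f \<in> wLp \<mu> \<omega> p \<longleftrightarrow> f \<in> borel_measurable borel \<and> modular f < \<infinity>"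
proof -
  have "borel_measurable \<mu> = (borel_measurable borel :: ('a \<Rightarrow> complex) set)"
    by (rule measurable_cong_sets[OF sets_mu refl])
  then show ?thesis
    unfolding wLp_def wLp_norm_def modular_def[symmetric] ennreal_root_less_top_iff by simp
qed

lemma wLp_norm_less_iff: "0 < \<epsilon> \<Longrightarrow> wLp_norm \<mu> \<omega> p f < ennreal \<epsilon> \<longleftrightarrow> modular f < ennreal (\<epsilon> powr p)"
  using p_pos by (simp only: wLp_norm_def modular_def[symmetric] ennreal_root_less_iff)

lemma dense_vector_iff:
  "dense_vector \<mu> S \<omega> p f \<longleftrightarrow> f \<in> borel_measurable borel \<and> modular f < \<infinity> \<and>
     (\<forall>g\<in>borel_measurable borel. modular g < \<infinity> \<longrightarrow>
       (\<forall>\<epsilon>>0. \<exists>s\<in>S. modular (\<lambda>t. translation s f t - g t) < ennreal \<epsilon>))"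
proof -
  have "(\<forall>\<epsilon>>0. \<exists>s\<in>S. wLp_norm \<mu> \<omega> p (\<lambda>t. translation s f t - g t) < ennreal \<epsilon>) \<longleftrightarrow>
      (\<forall>\<epsilon>>0. \<exists>s\<in>S. modular (\<lambda>t. translation s f t - g t) < ennreal \<epsilon>)" (is "?L \<longleftrightarrow> ?R") for g
  proof
    assume L: ?L
    show ?R
    proof (intro allI impI)
      fix \<epsilon> :: real assume "0 < \<epsilon>"
      then have "0 < \<epsilon> powr (1/p)" "(\<epsilon> powr (1/p)) powr p = \<epsilon>"
        using p_pos by (auto simp: powr_powr)
      then show "\<exists>s\<in>S. modular (\<lambda>t. translation s f t - g t) < ennreal \<epsilon>"
        using L wLp_norm_less_iff by metis
    qed
  next
    assume R: ?R
    show ?L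
    proof (intro allI impI)
      fix \<epsilon> :: real assume "0 < \<epsilon>"
      then show "\<exists>s\<in>S. wLp_norm \<mu> \<omega> p (\<lambda>t. translation s f t - g t) < ennreal \<epsilon>"
        using R[rule_format, of "\<epsilon> powr p"] by (simp add: wLp_norm_less_iff)
    qed
  qed
  then show ?thesis
    unfolding dense_vector_def mem_wLp_iff by (auto simp: mem_wLp_iff)
qed

lemma measurable_translation [measurable]:
  fixes f :: "'a \<Rightarrow> complex"
  assumes [measurable]: "f \<in> borel_measurable borel"
  shows "translation s f \<in> borel_measurable borel"
  unfolding translation_def by measurable

lemma modular_translation_le:
  assumes [measurable]: "h \<in> borel_measurable borel"
    and C: "0 \<le> C" "AE t in \<mu>. \<omega> (s + t) \<le> C * \<omega> t"
  shows "modular (translation s h) \<le> ennreal (C powr p) * modular h"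
proof -
  have "modular (translation s h) = (\<integral>\<^sup>+t. ennreal ((cmod (h t) * \<omega> (s + t)) powr p) \<partial>\<mu>)"
    unfolding modular_def translation_def cmod_weight
    by (subst nn_integral_left_add[where s = s, symmetric]) (simp_all add: add.assoc[symmetric])
  also have "\<dots> \<le> (\<integral>\<^sup>+t. ennreal (C powr p) * ennreal ((cmod (h t) * \<omega> t) powr p) \<partial>\<mu>)"
  proof (rule nn_integral_mono_AE, use C(2) in eventually_elim)
    case (elim t)
    have "(cmod (h t) * \<omega> (s + t)) powr p \<le> (C * (cmod (h t) * \<omega> t)) powr p"
      using mult_left_mono[OF elim, of "cmod (h t)"] weight_pos[of "s + t"] p_ge_1
      by (intro powr_mono2) (auto simp: mult_ac)
    then show ?case
      using C(1) weight_pos[of t] by (simp add: powr_mult ennreal_leI flip: ennreal_mult)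
  qed
  also have "\<dots> = ennreal (C powr p) * modular h"
    unfolding modular_def cmod_weight by (rule nn_integral_cmult) measurable
  finally show ?thesis .
qed

text \<open>
  Admissibility makes the translations by \<open>S\<close> bounded. It says nothing about their inverses, which is why
  the proofs below only ever apply \<open>T\<^sub>s\<close> with \<open>s \<in> S\<close> to functions that are not known explicitly.
\<close>

lemma translation_bound:
  assumes "admissible_weight \<mu> S \<omega>" "s \<in> S"
  obtains C where "1 \<le> C"
    "\<And>h. h \<in> borel_measurable borel \<Longrightarrow> modular (translation s h) \<le> ennreal C * modular h"
proof -
  let ?e = "esssup \<mu> (\<lambda>t. ennreal (\<omega> (s + t) / \<omega> t))"
  have "?e < \<infinity>"
    using assms by (simp add: admissible_weight_def)
  then obtain c where c: "0 \<le> c" "?e = ennreal c"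
    by (cases ?e) auto
  define C where "C = max c 1"
  have "AE t in \<mu>. ennreal (\<omega> (s + t) / \<omega> t) \<le> ?e"
    by (rule esssup_AE)
  then have "AE t in \<mu>. \<omega> (s + t) \<le> C * \<omega> t"
  proof eventually_elim
    case (elim t)
    then have "\<omega> (s + t) / \<omega> t \<le> c"
      using c by simp
    then have "\<omega> (s + t) \<le> c * \<omega> t"
      using weight_pos[of t] by (simp add: field_simps)
    also have "\<dots> \<le> C * \<omega> t"
      using weight_pos[of t] by (intro mult_right_mono) (auto simp: C_def)
    finally show ?case .
  qed
  then have "modular (translation s h) \<le> ennreal (C powr p) * modular h"
    if "h \<in> borel_measurable borel" for h
    using that by (intro modular_translation_le) (auto simp: C_def)
  moreover have "1 \<le> C powr p"
    using p_pos by (intro ge_one_powr_ge_zero) (auto simp: C_def)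
  ultimately show ?thesis using that by blast
qed

text \<open>
  The orbit of \<open>f\<close> contains a vector \<open>f\<^sub>1 = T\<^sub>r f\<close> close to the indicator of \<open>F\<close>, and \<open>f\<^sub>1\<close> has a translate
  \<open>f\<^sub>2 = T\<^sub>s f\<^sub>1\<close> close to three times that indicator. For the latter, \<open>T\<^sub>s f\<close> is made close to
  \<open>h = T\<^sub>r\<^sup>-\<^sup>1(3 \<cdot> 1\<^sub>F)\<close>, and the bounded operator \<open>T\<^sub>r\<close>, which commutes with \<open>T\<^sub>s\<close>, is applied to both sides.

  On most of \<open>F\<close> the value of \<open>f\<^sub>1\<close> is near \<open>1\<close> and that of \<open>f\<^sub>2\<close> near \<open>3\<close>. Hence on most of \<open>sF\<close> the value of
  \<open>f\<^sub>2\<close> is near \<open>1\<close>, although \<open>f\<^sub>2\<close> is close to a function with values \<open>0\<close> and \<open>3\<close>; and on most of \<open>s\<^sup>-\<^sup>1F\<close> the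
  value of \<open>f\<^sub>1\<close> is near \<open>3\<close>, although \<open>f\<^sub>1\<close> is close to a function with values \<open>0\<close> and \<open>1\<close>. By Chebyshev's
  inequality this is possible only if both sets have small mass. Since the two pairs of values are
  distinct in every case, it does not matter whether \<open>F\<close> meets \<open>sF\<close> or \<open>s\<^sup>-\<^sup>1F\<close>.
\<close>

lemma dense_vector_imp_Lp_condition:
  assumes adm: "admissible_weight \<mu> S \<omega>" and comm: "generates_abelian_subgroup S"
    and dense: "dense_vector \<mu> S \<omega> p f"
  shows "Lp_condition \<mu> S \<omega> p"
  unfolding Lp_condition_iff
proof (intro allI impI)
  fix F :: "'a set" and \<delta> :: real
  assume F: "compact F" and \<delta>: "0 < \<delta>"
  have [measurable]: "F \<in> sets borel" using borel_compact F .
  have f [measurable]: "f \<in> borel_measurable borel" "modular f < \<infinity>"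
    and approx: "\<And>g \<epsilon>. g \<in> borel_measurable borel \<Longrightarrow> modular g < \<infinity> \<Longrightarrow> 0 < \<epsilon> \<Longrightarrow>
       \<exists>s\<in>S. modular (\<lambda>t. translation s f t - g t) < ennreal \<epsilon>"
    using dense unfolding dense_vector_iff by auto
  obtain \<eta> :: real where \<eta>: "0 < \<eta>"
    "\<And>A. A \<in> sets borel \<Longrightarrow> A \<subseteq> F \<Longrightarrow> mass A < ennreal \<eta> \<Longrightarrow> emeasure \<mu> A < ennreal (\<delta> / 3)"
    using measure_small_of_mass_small[OF F, of "\<delta> / 3"] \<delta> by auto
  \<comment> \<open>Half of \<open>\<delta>\<^sup>p\<close> because the masses of \<open>sE\<close> and \<open>s\<^sup>-\<^sup>1E\<close> will be added.\<close>
  define m where "m = min \<eta> (\<delta> powr p / 2)"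
  have m: "0 < m" "m \<le> \<eta>" "m \<le> \<delta> powr p / 2"
    using \<eta> \<delta> by (auto simp: m_def)
  define e where "e = m / 2 powr p"
  have e: "0 < e" using m by (simp add: e_def)
  have cheb: "mass A < ennreal m"
    if "modular h < ennreal e" "A \<in> sets borel" "\<And>t. t \<in> A \<Longrightarrow> 1/2 \<le> cmod (h t)" for A h
  proof -
    have "ennreal ((1/2) powr p) * mass A \<le> modular h"
      using that by (intro mass_le_modular) auto
    also have "\<dots> < ennreal ((1/2) powr p * m)"
      using that(1) by (simp add: e_def powr_divide)
    also have "\<dots> = ennreal ((1/2) powr p) * ennreal m"
      using m by (intro ennreal_mult) auto
    finally show ?thesis
      by (meson leD leI mult_left_mono zero_le)
  qed
  have fin: "modular (\<lambda>t. c * indicator K t) < \<infinity>" if "compact K" for c K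
  proof -
    have "modular (\<lambda>t. c * indicator K t) \<le> ennreal (cmod c powr p) * mass K"
      using that borel_compact by (intro modular_le_mass) (auto simp: indicator_def norm_mult)
    also have "\<dots> < \<infinity>"
      using mass_compact[OF that] by (simp add: ennreal_mult_less_top)
    finally show ?thesis .
  qed
  have meas: "(\<lambda>t. c * indicator K t :: complex) \<in> borel_measurable borel" if "compact K" for c and K :: "'a set"
  proof -
    have [measurable]: "K \<in> sets borel" using borel_compact that .
    show ?thesis by measurable
  qed
  obtain r where r: "r \<in> S" "modular (\<lambda>t. translation r f t - 1 * indicator F t) < ennreal e"
    using approx[OF meas fin e] F by blast
  obtain C where C: "1 \<le> C"
    "\<And>h. h \<in> borel_measurable borel \<Longrightarrow> modular (translation r h) \<le> ennreal C * modular h"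
    using translation_bound[OF adm r(1)] by blast
  let ?F' = "ltranslate (- r) F"
  have F': "compact ?F'" using compact_ltranslate[OF F] .
  have "0 < e / 2 / C" using e C by auto
  then obtain s where s: "s \<in> S"
    "modular (\<lambda>t. translation s f t - 3 * indicator ?F' t) < ennreal (e / 2 / C)"
    using approx[OF meas[OF F'] fin[OF F']] by blast
  define f1 where "f1 = translation r f"
  define f2 where "f2 = translation s f1"
  have [measurable]: "f1 \<in> borel_measurable borel" "f2 \<in> borel_measurable borel"
    unfolding f1_def f2_def by measurable
  have "r + s = s + r"
    using comm r(1) s(1) hull_inc unfolding generates_abelian_subgroup_def by metis
  then have "- r + (- s + t) = - s + (- r + t)" for t
    by (metis add.assoc minus_add)
  then have f2: "(\<lambda>t. f2 t - 3 * indicator F t) = translation r (\<lambda>t. translation s f t - 3 * indicator ?F' t)"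
    by (auto simp: f1_def f2_def translation_def indicator_def mem_ltranslate_iff add.assoc[symmetric])
  have "modular (\<lambda>t. f2 t - 3 * indicator F t) \<le>
      ennreal C * modular (\<lambda>t. translation s f t - 3 * indicator ?F' t)"
    unfolding f2 using meas[OF F', of 3] by (intro C(2) borel_measurable_diff measurable_translation f(1))
  also have "\<dots> \<le> ennreal C * ennreal (e / 2 / C)"
    using s(2) by (intro mult_left_mono) auto
  also have "\<dots> = ennreal (e / 2)"
    using C e by (simp flip: ennreal_mult)
  also have "\<dots> < ennreal e"
    using e by (intro ennreal_lessI) auto
  finally have f2_e: "modular (\<lambda>t. f2 t - 3 * indicator F t) < ennreal e" .
  have f1_e: "modular (\<lambda>t. f1 t - indicator F t) < ennreal e"
    using r(2) by (simp add: f1_def)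
  define E1 where "E1 = {t \<in> F. cmod (f1 t - 1) < 1/2}"
  define E2 where "E2 = {t \<in> F. cmod (f2 t - 3) < 1/2}"
  have [measurable]: "E1 \<in> sets borel" "E2 \<in> sets borel"
    unfolding E1_def E2_def by measurable
  have "mass (F - E1) < ennreal m"
    by (rule cheb[OF f1_e]) (auto simp: E1_def)
  then have "mass (F - E1) < ennreal \<eta>"
    using m(2) by (meson ennreal_leI order_less_le_trans)
  then have FE1: "emeasure \<mu> (F - E1) < ennreal (\<delta> / 3)"
    by (intro \<eta>(2)) auto
  have "mass (F - E2) < ennreal m"
    by (rule cheb[OF f2_e]) (auto simp: E2_def)
  then have "mass (F - E2) < ennreal \<eta>"
    using m(2) by (meson ennreal_leI order_less_le_trans)
  then have FE2: "emeasure \<mu> (F - E2) < ennreal (\<delta> / 3)"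
    by (intro \<eta>(2)) auto
  have "E1 \<inter> E2 \<in> sets borel" "E1 \<inter> E2 \<subseteq> F" "0 < ennreal (\<delta> / 3)"
    using \<delta> by (auto simp: E1_def)
  then obtain E where E: "compact E" "E \<subseteq> E1 \<inter> E2" "emeasure \<mu> (E1 \<inter> E2 - E) < ennreal (\<delta> / 3)"
    using inner_approximation[OF F] by metis
  have [measurable]: "E \<in> sets borel" using borel_compact E(1) .
  have "emeasure \<mu> (F - E) < ennreal (3 * (\<delta> / 3))"
    using FE1 FE2 E(3) \<delta> by (intro emeasure_less_of_subset_Un3[of "F - E1" "F - E2" "E1 \<inter> E2 - E"]) auto
  then have FE: "emeasure \<mu> (F - E) < ennreal \<delta>" by simp
  have *: "1/2 \<le> cmod (z - a)" if "cmod (z - b) < 1/2" "1 \<le> cmod (b - a)" for z a b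
    using norm_triangle_ineq[of "b - z" "z - a"] that by (simp add: norm_minus_commute)
  have "mass (ltranslate s E) < ennreal m"
  proof (rule cheb[OF f2_e])
    fix t assume "t \<in> ltranslate s E"
    then have "- s + t \<in> E1" using E(2) by (auto simp: mem_ltranslate_iff)
    then have "cmod (f2 t - 1) < 1/2"
      by (simp add: f2_def translation_def E1_def)
    then show "1/2 \<le> cmod (f2 t - 3 * indicator F t)"
      by (rule *) (auto simp: indicator_def)
  qed (rule borel_compact_translates[OF E(1)])
  moreover have "mass (ltranslate (- s) E) < ennreal m"
  proof (rule cheb[OF f1_e])
    fix t assume "t \<in> ltranslate (- s) E"
    then have "s + t \<in> E2" using E(2) by (auto simp: mem_ltranslate_iff)
    then have "cmod (f1 t - 3) < 1/2"
      by (simp add: f2_def translation_def E2_def add.assoc[symmetric])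
    then show "1/2 \<le> cmod (f1 t - indicator F t)"
      by (rule *) (auto simp: indicator_def)
  qed (rule borel_compact_translates[OF E(1)])
  ultimately have "mass (ltranslate s E) + mass (ltranslate (- s) E) < ennreal m + ennreal m"
    by (rule add_strict_mono)
  also have "\<dots> \<le> ennreal (\<delta> powr p)"
    using m by (simp flip: ennreal_plus add: ennreal_leI)
  finally have "mass (ltranslate s E \<union> ltranslate (- s) E) < ennreal (\<delta> powr p)"
    using mass_Un_le[OF borel_compact_translates(1)[OF E(1)] borel_compact_translates(1)[OF E(1)]]
      order_le_less_trans by blast
  then show "\<exists>s\<in>S. \<exists>E. compact E \<and> E \<subseteq> F \<and> emeasure \<mu> (F - E) < ennreal \<delta> \<and>
        mass (ltranslate s E \<union> ltranslate (- s) E) < ennreal (\<delta> powr p)"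
    using s(1) E(1,2) FE by (auto simp: E1_def)
qed

section \<open>Countably many test functions are dense\<close>

lemma modular_add_less:
  assumes "f \<in> borel_measurable borel" "g \<in> borel_measurable borel" "0 < \<epsilon>"
    and "modular f < ennreal (\<epsilon> / 2 / 2 powr p)" "modular g < ennreal (\<epsilon> / 2 / 2 powr p)"
  shows "modular (\<lambda>t. f t + g t) < ennreal \<epsilon>"
proof -
  have "modular f + modular g < ennreal (\<epsilon> / 2 / 2 powr p) + ennreal (\<epsilon> / 2 / 2 powr p)"
    using assms(4,5) by (rule add_strict_mono)
  also have "\<dots> = ennreal (\<epsilon> / 2 powr p)"
    using assms(3) by (simp flip: ennreal_plus)
  finally have "ennreal (2 powr p) * (modular f + modular g) < ennreal (2 powr p) * ennreal (\<epsilon> / 2 powr p)"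
    by (intro ennreal_mult_strict_left_mono) auto
  also have "\<dots> = ennreal \<epsilon>"
    using assms(3) by (simp flip: ennreal_mult)
  finally show ?thesis
    using modular_add_le[OF assms(1,2)] by (rule order_le_less_trans[rotated])
qed

lemma modular_less_of_mass_less:
  assumes "A \<in> sets borel" "\<And>t. cmod (h t) \<le> C" "\<And>t. t \<notin> A \<Longrightarrow> h t = 0"
    and "0 < C" "0 < \<epsilon>" "mass A < ennreal (\<epsilon> / C powr p)"
  shows "modular h < ennreal \<epsilon>"
proof -
  have "modular h \<le> ennreal (C powr p) * mass A"
    using assms by (intro modular_le_mass)
  also have "\<dots> < ennreal (C powr p) * ennreal (\<epsilon> / C powr p)"
    using assms by (intro ennreal_mult_strict_left_mono) auto
  also have "\<dots> = ennreal \<epsilon>"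
    using assms by (simp flip: ennreal_mult)
  finally show ?thesis .
qed

text \<open>
  A second countable space has the Lindeloef property, so countably many open sets with compact
  supersets cover the group.
\<close>

lemma compact_exhaustion:
  obtains K :: "nat \<Rightarrow> 'a set" where "\<And>n. compact (K n)" "incseq K" "(\<Union>n. K n) = UNIV"
proof -
  let ?U = "{U :: 'a set. open U \<and> (\<exists>V. compact V \<and> U \<subseteq> V)}"
  obtain \<U> where \<U>: "\<U> \<subseteq> ?U" "countable \<U>" "\<Union>\<U> = \<Union>?U"
    using Lindelof[of ?U] by blast
  have "x \<in> \<Union>?U" for x :: 'a
    using locally_compact[unfolded locally_def, rule_format, of UNIV x] by (auto simp: openin_open)
  then have cover: "\<Union>\<U> = UNIV" using \<U>(3) by blast
  then have "\<U> \<noteq> {}" by auto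
  then have range: "range (from_nat_into \<U>) = \<U>"
    using \<U>(2) by (rule range_from_nat_into)
  have "\<exists>V. \<forall>n. compact (V n) \<and> from_nat_into \<U> n \<subseteq> V n"
    using range \<U>(1) by (intro choice) blast
  then obtain V where V: "\<And>n. compact (V n)" "\<And>n. from_nat_into \<U> n \<subseteq> V n"
    by blast
  show ?thesis
  proof (rule that[of "\<lambda>n. \<Union>i\<le>n. V i"])
    show "compact (\<Union>i\<le>n. V i)" for n
      using V(1) by (intro compact_UN) auto
    show "incseq (\<lambda>n. \<Union>i\<le>n. V i)"
      by (intro incseq_SucI UN_mono) auto
    have "x \<in> (\<Union>n. \<Union>i\<le>n. V i)" for x
    proof -
      have "x \<in> \<Union>\<U>" using cover by simp
      then obtain U where "U \<in> \<U>" "x \<in> U" by (rule UnionE)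
      then have "U \<in> range (from_nat_into \<U>)" using range by simp
      then obtain n where "U = from_nat_into \<U> n" by (rule rangeE)
      then have "x \<in> V n" using V(2)[of n] \<open>x \<in> U\<close> by auto
      then show ?thesis by auto
    qed
    then show "(\<Union>n. \<Union>i\<le>n. V i) = UNIV" by blast
  qed
qed

text \<open>
  Separability at the level of sets: \<open>A\<close> is close to an open \<open>U\<close> of finite measure, and \<open>U\<close> is the increasing
  union of finite unions of basic sets. Restricting to \<open>K\<close> makes it possible to pass from measure to mass.
\<close>

lemma borel_set_approximation:
  fixes b :: "nat \<Rightarrow> 'a set"
  assumes b: "topological_basis (range b)" and K: "compact K"
    and A [measurable]: "A \<in> sets borel" and AK: "A \<subseteq> K" and \<epsilon>: "0 < (\<epsilon>::real)"
  shows "\<exists>J. mass (sym_diff A ((\<Union>j\<in>set J. b j) \<inter> K)) < ennreal \<epsilon>"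
proof -
  have [measurable]: "K \<in> sets borel" using borel_compact K .
  have open_b: "open (b i)" for i
    using b by (auto simp: topological_basis_def)
  then have [measurable]: "b i \<in> sets borel" for i by simp
  obtain \<eta> :: real where \<eta>: "0 < \<eta>"
    "\<And>A. A \<in> sets borel \<Longrightarrow> A \<subseteq> K \<Longrightarrow> emeasure \<mu> A < ennreal \<eta> \<Longrightarrow> mass A < ennreal \<epsilon>"
    using mass_small_of_measure_small[OF K \<epsilon>] by blast
  have "emeasure \<mu> A \<le> emeasure \<mu> K"
    using AK by (intro emeasure_mono) (simp_all add: sets_mu)
  then have "emeasure \<mu> A < \<infinity>"
    using emeasure_compact[OF K] by (simp add: order_le_less_trans)
  moreover have "0 < ennreal (\<eta> / 2)" using \<eta> by simp
  ultimately obtain U where U: "open U" "A \<subseteq> U" "emeasure \<mu> U < \<infinity>" "emeasure \<mu> (U - A) < ennreal (\<eta> / 2)"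
    using outer_approximation[OF A] by metis
  have [measurable]: "U \<in> sets borel" using U by simp
  define I where "I n = filter (\<lambda>i. b i \<subseteq> U) [0..<n]" for n
  define V where "V n = (\<Union>j\<in>set (I n). b j)" for n
  have V: "V n = (\<Union>i\<in>{i. i < n \<and> b i \<subseteq> U}. b i)" for n
    by (auto simp: V_def I_def)
  have [measurable]: "V n \<in> sets borel" for n unfolding V_def by measurable
  have "(\<lambda>n. emeasure \<mu> (U - V n)) \<longlonglongrightarrow> emeasure \<mu> (\<Inter>n. U - V n)"
  proof (rule Lim_emeasure_decseq)
    show "range (\<lambda>n. U - V n) \<subseteq> sets \<mu>" by (auto simp: sets_mu)
    show "decseq (\<lambda>n. U - V n)"
      by (rule decseq_SucI) (auto simp: V)
    fix n
    have "emeasure \<mu> (U - V n) \<le> emeasure \<mu> U"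
      by (intro emeasure_mono) (auto simp: sets_mu)
    then show "emeasure \<mu> (U - V n) \<noteq> \<infinity>"
      using U(3) by (auto simp: top_unique)
  qed
  also have "(\<Inter>n. U - V n) = {}"
  proof -
    have "\<exists>n. x \<in> V n" if x: "x \<in> U" for x
    proof -
      obtain i where "x \<in> b i" "b i \<subseteq> U"
        using topological_basisE[OF b U(1) x] by blast
      then show ?thesis by (intro exI[of _ "Suc i"]) (auto simp: V)
    qed
    then show ?thesis by auto
  qed
  finally have "eventually (\<lambda>n. emeasure \<mu> (U - V n) < ennreal (\<eta> / 2)) sequentially"
    using \<eta> by (intro order_tendstoD(2)) auto
  then obtain n where n: "emeasure \<mu> (U - V n) < ennreal (\<eta> / 2)"
    by (auto simp: eventually_sequentially)
  have "V n \<subseteq> U" by (auto simp: V)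
  then have sub: "sym_diff A (V n \<inter> K) \<subseteq> (U - A) \<union> (U - V n)" "sym_diff A (V n \<inter> K) \<subseteq> K"
    using U(2) AK by blast+
  have "emeasure \<mu> (sym_diff A (V n \<inter> K)) \<le> emeasure \<mu> ((U - A) \<union> (U - V n))"
    by (rule emeasure_mono[OF sub(1)]) (simp add: sets_mu)
  also have "\<dots> \<le> emeasure \<mu> (U - A) + emeasure \<mu> (U - V n)"
    by (intro emeasure_subadditive) (simp_all add: sets_mu)
  also have "\<dots> < ennreal (\<eta> / 2) + ennreal (\<eta> / 2)"
    using U(4) n by (rule add_strict_mono)
  also have "\<dots> = ennreal \<eta>" using \<eta> by (simp flip: ennreal_plus)
  finally have "mass (sym_diff A (V n \<inter> K)) < ennreal \<epsilon>"
    by (intro \<eta>(2) sub(2)) measurable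
  then show ?thesis unfolding V_def by blast
qed

definition approximable :: "('a \<Rightarrow> complex) set \<Rightarrow> ('a \<Rightarrow> complex) \<Rightarrow> bool" where
  "approximable D h \<longleftrightarrow> h \<in> borel_measurable borel \<and> (\<forall>\<epsilon>>0. \<exists>d\<in>D. modular (\<lambda>t. h t - d t) < ennreal \<epsilon>)"

lemma approximable_closed:
  assumes D: "D \<subseteq> borel_measurable borel" and h: "h \<in> borel_measurable borel"
    and lim: "\<And>\<epsilon>::real. 0 < \<epsilon> \<Longrightarrow> \<exists>h'. approximable D h' \<and> modular (\<lambda>t. h t - h' t) < ennreal \<epsilon>"
  shows "approximable D h"
  unfolding approximable_def
proof (intro conjI allI impI h)
  fix \<epsilon> :: real assume "0 < \<epsilon>"
  then have \<epsilon>: "0 < \<epsilon> / 2 / 2 powr p" by simp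
  obtain h' where h': "approximable D h'" "modular (\<lambda>t. h t - h' t) < ennreal (\<epsilon> / 2 / 2 powr p)"
    using lim[OF \<epsilon>] by blast
  obtain d where d: "d \<in> D" "modular (\<lambda>t. h' t - d t) < ennreal (\<epsilon> / 2 / 2 powr p)"
    using h'(1) \<epsilon> unfolding approximable_def by blast
  have meas: "h' \<in> borel_measurable borel" "d \<in> borel_measurable borel"
    using h'(1) D d(1) by (auto simp: approximable_def)
  have "modular (\<lambda>t. (h t - h' t) + (h' t - d t)) < ennreal \<epsilon>"
    using h meas h'(2) d(2) \<open>0 < \<epsilon>\<close> by (intro modular_add_less borel_measurable_diff) auto
  then show "\<exists>d\<in>D. modular (\<lambda>t. h t - d t) < ennreal \<epsilon>"
    using d(1) by (intro bexI[of _ d]) simp_all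
qed

lemma approximable_add:
  assumes D: "D \<subseteq> borel_measurable borel" "\<And>d e. d \<in> D \<Longrightarrow> e \<in> D \<Longrightarrow> (\<lambda>t. d t + e t) \<in> D"
    and f: "approximable D f" and g: "approximable D g"
  shows "approximable D (\<lambda>t. f t + g t)"
  unfolding approximable_def
proof (intro conjI allI impI)
  have fg: "f \<in> borel_measurable borel" "g \<in> borel_measurable borel"
    using f g by (auto simp: approximable_def)
  then show "(\<lambda>t. f t + g t) \<in> borel_measurable borel" by (intro borel_measurable_add)
  fix \<epsilon> :: real assume \<epsilon>: "0 < \<epsilon>"
  then have \<epsilon>': "0 < \<epsilon> / 2 / 2 powr p" by simp
  obtain d where d: "d \<in> D" "modular (\<lambda>t. f t - d t) < ennreal (\<epsilon> / 2 / 2 powr p)"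
    using f \<epsilon>' unfolding approximable_def by blast
  obtain e where e: "e \<in> D" "modular (\<lambda>t. g t - e t) < ennreal (\<epsilon> / 2 / 2 powr p)"
    using g \<epsilon>' unfolding approximable_def by blast
  have de: "e \<in> borel_measurable borel" "d \<in> borel_measurable borel"
    using D(1) d(1) e(1) by auto
  have "modular (\<lambda>t. (f t - d t) + (g t - e t)) < ennreal \<epsilon>"
    using fg de d(2) e(2) \<epsilon> by (intro modular_add_less borel_measurable_diff) auto
  then have "modular (\<lambda>t. (f t + g t) - (d t + e t)) < ennreal \<epsilon>"
    by (simp add: algebra_simps)
  then show "\<exists>d\<in>D. modular (\<lambda>t. f t + g t - d t) < ennreal \<epsilon>"
    using D(2)[OF d(1) e(1)] by (rule bexI)
qed

lemma modular_zero [simp]: "modular (\<lambda>t. 0) = 0"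
  by (simp add: modular_def)

lemma modular_indicator_diff_less:
  assumes [measurable]: "A \<in> sets borel" "B \<in> sets borel"
    and "0 < \<epsilon>" "mass (sym_diff A B) < ennreal (\<epsilon> / (cmod c + 1) powr p)"
  shows "modular (\<lambda>t. c * indicator A t - c * indicator B t) < ennreal \<epsilon>"
proof (rule modular_less_of_mass_less[where A = "sym_diff A B" and C = "cmod c + 1"])
  show "sym_diff A B \<in> sets borel" by measurable
  show "0 < cmod c + 1" by (simp add: add_nonneg_pos)
qed (use assms in \<open>auto simp: indicator_def\<close>)

text \<open>
  Bounded Borel functions of compact support; continuity is not asked for because the constructions below
  cut functions off along compact sets.
\<close>

definition test_function :: "('a \<Rightarrow> complex) \<Rightarrow> bool" where
  "test_function f \<longleftrightarrow> f \<in> borel_measurable borel \<and>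
     (\<exists>C K. compact K \<and> (\<forall>t. cmod (f t) \<le> C) \<and> (\<forall>t. t \<notin> K \<longrightarrow> f t = 0))"

lemma test_function_measurable: "test_function f \<Longrightarrow> f \<in> borel_measurable borel"
  by (simp add: test_function_def)

lemma test_function_common_bounds:
  assumes "test_function f" "test_function g"
  obtains C K where "1 \<le> C" "compact K" "\<And>t. cmod (f t) \<le> C" "\<And>t. cmod (g t) \<le> C"
    "\<And>t. t \<notin> K \<Longrightarrow> f t = 0" "\<And>t. t \<notin> K \<Longrightarrow> g t = 0"
proof -
  obtain C1 K1 where f: "compact K1" "\<And>t. cmod (f t) \<le> C1" "\<And>t. t \<notin> K1 \<Longrightarrow> f t = 0"
    using assms(1) by (auto simp: test_function_def)
  obtain C2 K2 where g: "compact K2" "\<And>t. cmod (g t) \<le> C2" "\<And>t. t \<notin> K2 \<Longrightarrow> g t = 0"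
    using assms(2) by (auto simp: test_function_def)
  show ?thesis
    by (rule that[of "max 1 (max C1 C2)" "K1 \<union> K2"])
      (use f g in \<open>auto simp: le_max_iff_disj\<close>)
qed

lemma test_function_add:
  assumes "test_function f" "test_function g"
  shows "test_function (\<lambda>t. f t + g t)"
proof -
  obtain C K where *: "1 \<le> C" "compact K" "\<And>t. cmod (f t) \<le> C" "\<And>t. cmod (g t) \<le> C"
    "\<And>t. t \<notin> K \<Longrightarrow> f t = 0" "\<And>t. t \<notin> K \<Longrightarrow> g t = 0"
    using test_function_common_bounds[OF assms] by blast
  have "cmod (f t + g t) \<le> C + C" for t
    using *(3,4)[of t] norm_triangle_ineq[of "f t" "g t"] by linarith
  moreover have "(\<lambda>t. f t + g t) \<in> borel_measurable borel"
    using assms by (intro borel_measurable_add test_function_measurable)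
  ultimately show ?thesis
    using * unfolding test_function_def by (intro conjI exI[of _ "C + C"] exI[of _ K]) auto
qed

lemma test_function_mult_indicator:
  assumes "test_function f" "compact E"
  shows "test_function (\<lambda>t. f t * indicator E t)"
proof -
  obtain C K where *: "compact K" "\<And>t. cmod (f t) \<le> C" "\<And>t. t \<notin> K \<Longrightarrow> f t = 0"
    using assms(1) by (auto simp: test_function_def)
  have [measurable]: "E \<in> sets borel" "f \<in> borel_measurable borel"
    using assms borel_compact test_function_measurable by auto
  have "(\<lambda>t. f t * indicator E t) \<in> borel_measurable borel" by measurable
  moreover have "cmod (f t * indicator E t) \<le> C" for t
    using *(2)[of t] norm_ge_zero[of "f t"] by (auto simp: indicator_def simp del: norm_ge_zero)
  ultimately show ?thesis
    using *(1,3) unfolding test_function_def by (intro conjI exI[of _ C] exI[of _ K]) auto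
qed

lemma test_function_translation:
  assumes "test_function f"
  shows "test_function (translation s f)"
proof -
  obtain C K where *: "compact K" "\<And>t. cmod (f t) \<le> C" "\<And>t. t \<notin> K \<Longrightarrow> f t = 0"
    using assms(1) by (auto simp: test_function_def)
  show ?thesis
    unfolding test_function_def
    using * compact_ltranslate[OF *(1), of s] measurable_translation[OF test_function_measurable[OF assms]]
    by (intro conjI exI[of _ C] exI[of _ "ltranslate s K"]) (auto simp: translation_def mem_ltranslate_iff)
qed

lemma test_function_const_indicator:
  assumes [measurable]: "A \<in> sets borel" and "compact K" "A \<subseteq> K"
  shows "test_function (\<lambda>t. c * indicator A t)"
  unfolding test_function_def
  using assms by (intro conjI exI[of _ "cmod c"] exI[of _ K]) (auto simp: indicator_def)

text \<open>
  Dominated convergence: \<open>\<bar>h - \<sigma> n 1\<^bsub>K n\<^esub>\<bar> \<le> 3\<bar>h\<bar>\<close>, since \<open>\<bar>\<sigma> n\<bar> \<le> 2\<bar>h\<bar>\<close>.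
\<close>

lemma modular_truncated_simple_limit:
  assumes [measurable]: "h \<in> borel_measurable borel" "\<And>n. \<sigma> n \<in> borel_measurable borel" "\<And>n. K n \<in> sets borel"
    and fin: "modular h < \<infinity>"
    and lim: "\<And>t. (\<lambda>n. \<sigma> n t) \<longlonglongrightarrow> h t" and bound: "\<And>n t. cmod (\<sigma> n t) \<le> 2 * cmod (h t)"
    and K: "incseq K" "(\<Union>n. K n) = UNIV"
  shows "(\<lambda>n. modular (\<lambda>t. h t - \<sigma> n t * indicator (K n) t)) \<longlonglongrightarrow> 0"
proof -
  let ?u = "\<lambda>n t. ennreal ((cmod (h t - \<sigma> n t * indicator (K n) t) * \<omega> t) powr p)"
  have "(\<lambda>n. \<integral>\<^sup>+t. ?u n t \<partial>\<mu>) \<longlonglongrightarrow> (\<integral>\<^sup>+t. 0 \<partial>\<mu>)"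
  proof (rule nn_integral_dominated_convergence[where w = "\<lambda>t. ennreal (3 powr p) * ennreal ((cmod (h t) * \<omega> t) powr p)"])
    show "(\<integral>\<^sup>+t. ennreal (3 powr p) * ennreal ((cmod (h t) * \<omega> t) powr p) \<partial>\<mu>) < \<infinity>"
      using fin unfolding modular_def cmod_weight
      by (subst nn_integral_cmult) (simp_all add: ennreal_mult_less_top)
    show "AE t in \<mu>. ?u n t \<le> ennreal (3 powr p) * ennreal ((cmod (h t) * \<omega> t) powr p)" for n
    proof (rule AE_I2)
      fix t
      have "cmod (\<sigma> n t * indicator (K n) t) \<le> 2 * cmod (h t)"
        using bound[of n t] by (auto simp: indicator_def)
      then have "cmod (h t - \<sigma> n t * indicator (K n) t) \<le> 3 * cmod (h t)"
        using norm_triangle_ineq4[of "h t" "\<sigma> n t * indicator (K n) t"] by linarith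
      then have "(cmod (h t - \<sigma> n t * indicator (K n) t) * \<omega> t) powr p \<le> (3 * (cmod (h t) * \<omega> t)) powr p"
        using weight_pos[of t] p_ge_1
        by (intro powr_mono2) (auto simp: mult.assoc[symmetric] intro!: mult_right_mono)
      then show "?u n t \<le> ennreal (3 powr p) * ennreal ((cmod (h t) * \<omega> t) powr p)"
        using weight_pos[of t] by (simp add: powr_mult ennreal_leI flip: ennreal_mult)
    qed
    show "AE t in \<mu>. (\<lambda>n. ?u n t) \<longlonglongrightarrow> 0"
    proof (rule AE_I2)
      fix t
      obtain m where "t \<in> K m" using K(2) by blast
      then have "t \<in> K n" if "m \<le> n" for n
        using incseqD[OF K(1) that] by blast
      then have "eventually (\<lambda>n. \<sigma> n t = \<sigma> n t * indicator (K n) t) sequentially"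
        by (intro eventually_sequentiallyI[of m]) simp
      then have "(\<lambda>n. \<sigma> n t * indicator (K n) t) \<longlonglongrightarrow> h t"
        using lim[of t] by (rule Lim_transform_eventually[rotated])
      then have "(\<lambda>n. (cmod (h t - \<sigma> n t * indicator (K n) t) * \<omega> t) powr p) \<longlonglongrightarrow> (cmod (h t - h t) * \<omega> t) powr p"
        using p_pos weight_pos[of t] by (intro tendsto_intros tendsto_powr') (auto intro!: always_eventually)
      then have "(\<lambda>n. ?u n t) \<longlonglongrightarrow> ennreal ((cmod (h t - h t) * \<omega> t) powr p)"
        by (rule tendsto_ennrealI)
      then show "(\<lambda>n. ?u n t) \<longlonglongrightarrow> 0" by simp
    qed
  qed measurable
  then show ?thesis
    unfolding modular_def cmod_weight by simp
qed

text \<open>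
  The countable family consists of the finite sums of \<open>q i\<close> times the indicator of a finite union of basic
  sets cut off by a member of the exhaustion, where \<open>q\<close> enumerates a dense set of complex numbers. The
  functions approximable by it are found in growing generality: coefficient \<open>q i\<close> and Borel set, arbitrary
  coefficient, simple function, arbitrary function of finite modular.
\<close>

lemma countable_dense_test_functions:
  obtains g :: "nat \<Rightarrow> 'a \<Rightarrow> complex" where "\<And>n. test_function (g n)"
    "\<And>h \<epsilon>. h \<in> borel_measurable borel \<Longrightarrow> modular h < \<infinity> \<Longrightarrow> 0 < \<epsilon> \<Longrightarrow>
       \<exists>n. modular (\<lambda>t. h t - g n t) < ennreal \<epsilon>"
proof -
  obtain K :: "nat \<Rightarrow> 'a set" where K: "\<And>n. compact (K n)" "incseq K" "(\<Union>n. K n) = UNIV"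
    using compact_exhaustion by blast
  have [measurable]: "K n \<in> sets borel" for n using borel_compact[OF K(1)] .
  obtain \<B> :: "'a set set" where \<B>: "countable \<B>" "topological_basis \<B>"
    using ex_countable_basis by blast
  define b where "b = from_nat_into \<B>"
  have "\<B> \<noteq> {}"
    using topological_basisE[OF \<B>(2) open_UNIV UNIV_I] by blast
  then have b: "topological_basis (range b)"
    using \<B> by (simp add: b_def range_from_nat_into)
  have [measurable]: "b i \<in> sets borel" for i
    using b by (auto simp: topological_basis_def)
  obtain Q :: "complex set" where Q: "countable Q" "\<And>X. open X \<Longrightarrow> X \<noteq> {} \<Longrightarrow> \<exists>d\<in>Q. d \<in> X"
    using countable_dense_setE by blast
  define q where "q = from_nat_into Q"
  have "Q \<noteq> {}" using Q(2)[of UNIV] by auto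
  then have q: "range q = Q" using Q(1) by (simp add: q_def range_from_nat_into)
  define B where "B J m = (\<Union>j\<in>set J. b j) \<inter> K m" for J m
  have [measurable]: "B J m \<in> sets borel" for J m unfolding B_def by measurable
  define G :: "(nat \<times> nat list \<times> nat) list \<Rightarrow> 'a \<Rightarrow> complex" where
    "G l t = (\<Sum>(i, J, m)\<leftarrow>l. q i * indicator (B J m) t)" for l t
  have test_G: "test_function (G l)" for l
  proof (induction l)
    case Nil
    show ?case by (auto simp: G_def test_function_def intro: exI[of _ 0] exI[of _ "{}"])
  next
    case (Cons x l)
    obtain i J m where x: "x = (i, J, m)" by (cases x)
    have "test_function (\<lambda>t. q i * indicator (B J m) t)"
      by (rule test_function_const_indicator[OF _ K(1)[of m]]) (auto simp: B_def)
    then have "test_function (\<lambda>t. q i * indicator (B J m) t + G l t)"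
      by (rule test_function_add[OF _ Cons.IH])
    then show ?case by (simp add: G_def x)
  qed
  let ?D = "range G"
  have D: "?D \<subseteq> borel_measurable borel"
    using test_G test_function_measurable by blast
  have D_add: "(\<lambda>t. d t + e t) \<in> ?D" if "d \<in> ?D" "e \<in> ?D" for d e
  proof -
    obtain k l where "d = G k" "e = G l" using \<open>d \<in> ?D\<close> \<open>e \<in> ?D\<close> by blast
    then have "(\<lambda>t. d t + e t) = G (k @ l)" by (auto simp: G_def)
    then show ?thesis by blast
  qed
  have D_zero: "approximable ?D (\<lambda>t. 0)"
    unfolding approximable_def by (auto simp: G_def intro!: exI[of _ "[]"])
  have ind_q: "approximable ?D (\<lambda>t. q i * indicator A t)"
    if A': "A \<in> sets borel" and A: "A \<subseteq> K m" for i A m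
    unfolding approximable_def
  proof (intro conjI allI impI)
    have [measurable]: "A \<in> sets borel" by (rule A')
    show "(\<lambda>t. q i * indicator A t) \<in> borel_measurable borel" by measurable
    fix \<epsilon> :: real assume \<epsilon>: "0 < \<epsilon>"
    have "0 < \<epsilon> / (cmod (q i) + 1) powr p"
      using \<epsilon> norm_ge_zero[of "q i"] by (simp add: add_nonneg_eq_0_iff)
    then obtain J where "mass (sym_diff A (B J m)) < ennreal (\<epsilon> / (cmod (q i) + 1) powr p)"
      using borel_set_approximation[OF b K(1) A' A] unfolding B_def by blast
    then have "modular (\<lambda>t. q i * indicator A t - q i * indicator (B J m) t) < ennreal \<epsilon>"
      using \<epsilon> A' by (intro modular_indicator_diff_less) simp_all
    then show "\<exists>d\<in>?D. modular (\<lambda>t. q i * indicator A t - d t) < ennreal \<epsilon>"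
      by (intro bexI[of _ "G [(i, J, m)]"]) (simp_all add: G_def)
  qed
  have ind: "approximable ?D (\<lambda>t. c * indicator A t)"
    if [measurable]: "A \<in> sets borel" and A: "A \<subseteq> K m" for c A m
  proof (rule approximable_closed[OF D])
    show "(\<lambda>t. c * indicator A t) \<in> borel_measurable borel" by measurable
    fix \<epsilon> :: real assume \<epsilon>: "0 < \<epsilon>"
    obtain x where x: "0 \<le> x" "mass A = ennreal x"
      using mass_compact[OF K(1)[of m]] mass_mono[OF A] by (cases "mass A") auto
    define r where "r = (\<epsilon> / (x + 1)) powr (1 / p)"
    have r: "0 < r" "r powr p = \<epsilon> / (x + 1)"
      using \<epsilon> x p_pos by (auto simp: r_def powr_powr)
    obtain i where i: "cmod (c - q i) < r"
      using Q(2)[of "ball c r"] r(1) q by (auto simp: dist_norm)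
    have "modular (\<lambda>t. (c - q i) * indicator A t) \<le> ennreal (r powr p) * mass A"
      using i r by (intro modular_le_mass) (auto simp: indicator_def)
    also have "\<dots> = ennreal (\<epsilon> * (x / (x + 1)))"
      using \<epsilon> x r by (simp flip: ennreal_mult)
    also have "\<dots> < ennreal \<epsilon>"
      using \<epsilon> x by (intro ennreal_lessI) (auto simp: field_simps)
    finally have "modular (\<lambda>t. c * indicator A t - q i * indicator A t) < ennreal \<epsilon>"
      by (simp add: left_diff_distrib)
    then show "\<exists>h'. approximable ?D h' \<and> modular (\<lambda>t. c * indicator A t - h' t) < ennreal \<epsilon>"
      using ind_q[OF that] by blast
  qed
  have simple: "approximable ?D (\<lambda>t. \<sigma> t * indicator (K m) t)"
    if \<sigma>: "simple_function borel \<sigma>" for \<sigma> m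
  proof -
    have fin: "finite (range \<sigma>)" using \<sigma> by (auto simp: simple_function_def)
    have "approximable ?D (\<lambda>t. \<Sum>y\<in>Y. y * indicator (\<sigma> -` {y} \<inter> K m) t)" if "finite Y" "Y \<subseteq> range \<sigma>" for Y
      using that
    proof (induction Y rule: finite_induct)
      case empty
      show ?case using D_zero by simp
    next
      case (insert y Y)
      have "\<sigma> -` {y} \<in> sets borel"
        using \<sigma> insert.prems by (auto simp: simple_function_def)
      then have "approximable ?D (\<lambda>t. y * indicator (\<sigma> -` {y} \<inter> K m) t)"
        by (intro ind[of _ m]) auto
      then have "approximable ?D (\<lambda>t. y * indicator (\<sigma> -` {y} \<inter> K m) t + (\<Sum>y\<in>Y. y * indicator (\<sigma> -` {y} \<inter> K m) t))"
        using insert by (intro approximable_add D D_add) auto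
      then show ?case unfolding sum.insert[OF insert.hyps] .
    qed
    from this[OF fin subset_refl]
    have "approximable ?D (\<lambda>t. \<Sum>y\<in>range \<sigma>. y * indicator (\<sigma> -` {y} \<inter> K m) t)" .
    also have "(\<lambda>t. \<Sum>y\<in>range \<sigma>. y * indicator (\<sigma> -` {y} \<inter> K m) t) = (\<lambda>t. \<sigma> t * indicator (K m) t)"
    proof
      fix t
      have "(\<Sum>y\<in>range \<sigma>. y * indicator (\<sigma> -` {y} \<inter> K m) t) =
          (\<Sum>y\<in>range \<sigma>. if y = \<sigma> t then \<sigma> t * indicator (K m) t else 0)"
        by (intro sum.cong) (auto simp: indicator_def)
      then show "(\<Sum>y\<in>range \<sigma>. y * indicator (\<sigma> -` {y} \<inter> K m) t) = \<sigma> t * indicator (K m) t"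
        using fin by simp
    qed
    finally show ?thesis .
  qed
  have all: "approximable ?D h" if h [measurable]: "h \<in> borel_measurable borel" and fin: "modular h < \<infinity>" for h
  proof (rule approximable_closed[OF D h])
    fix \<epsilon> :: real assume \<epsilon>: "0 < \<epsilon>"
    obtain \<sigma> where \<sigma>: "\<And>n. simple_function borel (\<sigma> n)" "\<And>t. (\<lambda>n. \<sigma> n t) \<longlonglongrightarrow> h t"
      "\<And>n t. cmod (\<sigma> n t) \<le> 2 * cmod (h t)"
      using borel_measurable_implies_sequence_metric[OF h, of 0] by auto
    have "(\<lambda>n. modular (\<lambda>t. h t - \<sigma> n t * indicator (K n) t)) \<longlonglongrightarrow> 0"
      using \<sigma> K(2,3) fin borel_measurable_simple_function[OF \<sigma>(1)]
      by (intro modular_truncated_simple_limit) auto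
    then have "eventually (\<lambda>n. modular (\<lambda>t. h t - \<sigma> n t * indicator (K n) t) < ennreal \<epsilon>) sequentially"
      using \<epsilon> by (intro order_tendstoD(2)) auto
    then obtain n where "modular (\<lambda>t. h t - \<sigma> n t * indicator (K n) t) < ennreal \<epsilon>"
      by (auto simp: eventually_sequentially)
    then show "\<exists>h'. approximable ?D h' \<and> modular (\<lambda>t. h t - h' t) < ennreal \<epsilon>"
      using simple[OF \<sigma>(1)] by blast
  qed
  show ?thesis
  proof (rule that[of "\<lambda>n. G (from_nat n)"])
    show "test_function (G (from_nat n))" for n by (rule test_G)
    fix h and \<epsilon> :: real
    assume "h \<in> borel_measurable borel" "modular h < \<infinity>" "0 < \<epsilon>"
    then obtain l where "modular (\<lambda>t. h t - G l t) < ennreal \<epsilon>"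
      using all unfolding approximable_def by blast
    then show "\<exists>n. modular (\<lambda>t. h t - G (from_nat n) t) < ennreal \<epsilon>"
      by (intro exI[of _ "to_nat l"]) simp
  qed
qed

section \<open>Construction of a dense vector\<close>

text \<open>
  Any test function \<open>f\<close> can be changed by a small amount so that some \<open>T\<^sub>s\<close> takes it near a given test function
  \<open>g\<close>: with \<open>s\<close> and \<open>E\<close> from the condition for a common support \<open>K\<close>, take \<open>f' = f 1\<^sub>E + T\<^sub>s\<^sup>-\<^sup>1(g 1\<^sub>E)\<close>. The second
  summand is bounded and lives on \<open>s\<^sup>-\<^sup>1E\<close>, so it is small; likewise \<open>T\<^sub>s(f 1\<^sub>E)\<close> lives on \<open>sE\<close>, and the part of \<open>f\<close>
  and \<open>g\<close> that is cut off lives on \<open>K - E\<close>.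
\<close>

lemma topologically_transitive:
  assumes Lp: "Lp_condition \<mu> S \<omega> p" and f: "test_function f" and g: "test_function g" and \<epsilon>: "0 < (\<epsilon>::real)"
  shows "\<exists>s\<in>S. \<exists>f'. test_function f' \<and> modular (\<lambda>t. f' t - f t) < ennreal \<epsilon> \<and>
    modular (\<lambda>t. translation s f' t - g t) < ennreal \<epsilon>"
proof -
  obtain C K where C: "1 \<le> C" and K: "compact K"
    and fC: "\<And>t. cmod (f t) \<le> C" and gC: "\<And>t. cmod (g t) \<le> C"
    and fK: "\<And>t. t \<notin> K \<Longrightarrow> f t = 0" and gK: "\<And>t. t \<notin> K \<Longrightarrow> g t = 0"
    using test_function_common_bounds[OF f g] by blast
  define e where "e = \<epsilon> / 2 / 2 powr p"
  have e: "0 < e" using \<epsilon> by (simp add: e_def)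
  define e' where "e' = e / C powr p"
  have e': "0 < e'" using e C by (simp add: e'_def)
  obtain \<eta> :: real where \<eta>: "0 < \<eta>"
    "\<And>A. A \<in> sets borel \<Longrightarrow> A \<subseteq> K \<Longrightarrow> emeasure \<mu> A < ennreal \<eta> \<Longrightarrow> mass A < ennreal e'"
    using mass_small_of_measure_small[OF K e'] by blast
  \<comment> \<open>One \<open>\<delta>\<close> controls both parts of the condition: measure through \<open>\<eta>\<close>, mass through \<open>\<delta>\<^sup>p \<le> e'\<close>.\<close>
  define \<delta> where "\<delta> = min \<eta> (e' powr (1 / p))"
  have \<delta>: "0 < \<delta>" "\<delta> \<le> \<eta>" "\<delta> \<le> e' powr (1 / p)" using \<eta> e' by (auto simp: \<delta>_def)
  have "\<delta> powr p \<le> (e' powr (1 / p)) powr p"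
    using \<delta> p_pos by (intro powr_mono2) auto
  then have \<delta>p: "\<delta> powr p \<le> e'"
    using e' p_pos by (simp add: powr_powr)
  obtain s E where s: "s \<in> S" and E: "compact E" "E \<subseteq> K" "emeasure \<mu> (K - E) < ennreal \<delta>"
    and mass: "mass (ltranslate s E \<union> ltranslate (- s) E) < ennreal (\<delta> powr p)"
    using Lp[unfolded Lp_condition_iff] K \<delta>(1) by meson
  have Eb: "E \<in> sets borel" "K \<in> sets borel" using borel_compact E(1) K by auto
  have KE: "mass (K - E) < ennreal e'"
    using \<eta>(2)[of "K - E"] Eb E(3) \<delta>(2) by (meson Diff_subset ennreal_leI order_less_le_trans sets.Diff)
  have sE: "mass (ltranslate r E) < ennreal e'" if "r = s \<or> r = - s" for r
  proof -
    have "mass (ltranslate r E) \<le> mass (ltranslate s E \<union> ltranslate (- s) E)"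
      using that by (intro mass_mono) auto
    then show ?thesis
      using mass \<delta>p by (meson ennreal_leI order_le_less_trans order_less_le_trans)
  qed
  have small: "modular h < ennreal e"
    if "A \<in> sets borel" "\<And>t. cmod (h t) \<le> C" "\<And>t. t \<notin> A \<Longrightarrow> h t = 0" "mass A < ennreal e'" for h A
    using that e C unfolding e'_def by (intro modular_less_of_mass_less) auto
  define fE where "fE = (\<lambda>t. f t * indicator E t)"
  define gE where "gE = (\<lambda>t. g t * indicator E t)"
  have test: "test_function fE" "test_function gE"
    unfolding fE_def gE_def using f g E(1) by (auto intro: test_function_mult_indicator)
  have bounds: "cmod (fE t) \<le> C" "cmod (gE t) \<le> C" for t
    using fC[of t] gC[of t] C by (auto simp: fE_def gE_def indicator_def)
  have off: "fE t = 0" "gE t = 0" if "t \<notin> E" for t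
    using that by (auto simp: fE_def gE_def)
  define f' where "f' = (\<lambda>t. fE t + translation (- s) gE t)"
  have "test_function f'"
    unfolding f'_def by (intro test_function_add test_function_translation test)
  moreover have "modular (\<lambda>t. f' t - f t) < ennreal \<epsilon>"
  proof -
    have "modular (\<lambda>t. fE t - f t) < ennreal e"
    proof (rule small[OF _ _ _ KE])
      show "cmod (fE t - f t) \<le> C" for t
        using fC[of t] C by (auto simp: fE_def indicator_def)
      show "fE t - f t = 0" if "t \<notin> K - E" for t
        using that fK[of t] by (auto simp: fE_def indicator_def)
    qed (use Eb in auto)
    moreover have "modular (translation (- s) gE) < ennreal e"
    proof (rule small[OF borel_compact_translates(1)[OF E(1)] _ _ sE])
      show "translation (- s) gE t = 0" if "t \<notin> ltranslate (- s) E" for t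
        using that off(2) by (auto simp: translation_def mem_ltranslate_iff)
    qed (use bounds in \<open>auto simp: translation_def\<close>)
    ultimately have "modular (\<lambda>t. (fE t - f t) + translation (- s) gE t) < ennreal \<epsilon>"
      using \<epsilon> test f unfolding e_def
      by (intro modular_add_less borel_measurable_diff measurable_translation test_function_measurable)
    then show ?thesis by (simp add: f'_def algebra_simps)
  qed
  moreover have "modular (\<lambda>t. translation s f' t - g t) < ennreal \<epsilon>"
  proof -
    have "modular (\<lambda>t. gE t - g t) < ennreal e"
    proof (rule small[OF _ _ _ KE])
      show "cmod (gE t - g t) \<le> C" for t
        using gC[of t] C by (auto simp: gE_def indicator_def)
      show "gE t - g t = 0" if "t \<notin> K - E" for t
        using that gK[of t] by (auto simp: gE_def indicator_def)
    qed (use Eb in auto)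
    moreover have "modular (translation s fE) < ennreal e"
    proof (rule small[OF borel_compact_translates(1)[OF E(1)] _ _ sE])
      show "translation s fE t = 0" if "t \<notin> ltranslate s E" for t
        using that off(1) by (auto simp: translation_def mem_ltranslate_iff)
    qed (use bounds in \<open>auto simp: translation_def\<close>)
    ultimately have "modular (\<lambda>t. translation s fE t + (gE t - g t)) < ennreal \<epsilon>"
      using \<epsilon> test g unfolding e_def
      by (intro modular_add_less borel_measurable_diff measurable_translation test_function_measurable)
    moreover have "translation s f' t = translation s fE t + gE t" for t
      by (simp add: f'_def translation_def add.assoc[symmetric])
    ultimately show ?thesis by (simp add: algebra_simps)
  qed
  ultimately show ?thesis using s by blast
qed

text \<open>
  The pointwise estimate of a series, integrated.
\<close>

lemma modular_suminf_le:
  assumes d [measurable]: "\<And>k. d k \<in> borel_measurable borel"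
    and fin: "(\<Sum>k. ennreal (2 powr (p * Suc k)) * modular (d k)) < \<infinity>" (is "?B < _")
  shows "AE t in \<mu>. summable (\<lambda>k. d k t)" and "modular (\<lambda>t. \<Sum>k. d k t) \<le> ?B"
proof -
  define H where "H t = (\<Sum>k. ennreal ((2 ^ Suc k * cmod (d k t * complex_of_real (\<omega> t))) powr p))" for t
  have [measurable]: "H \<in> borel_measurable borel" unfolding H_def by measurable
  have H: "integral\<^sup>N \<mu> H = ?B"
  proof -
    have *: "ennreal ((2 ^ Suc k * cmod (d k t * complex_of_real (\<omega> t))) powr p) =
        ennreal (2 powr (p * Suc k)) * ennreal ((cmod (d k t) * \<omega> t) powr p)" for k t
    proof -
      have "((2::real) ^ Suc k) powr p = 2 powr (p * Suc k)"
        by (simp add: powr_powr mult.commute del: power_Suc of_nat_Suc flip: powr_realpow)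
      then show ?thesis
        using weight_pos[of t] by (simp add: powr_mult ennreal_mult del: power_Suc of_nat_Suc)
    qed
    have "integral\<^sup>N \<mu> H = (\<Sum>k. \<integral>\<^sup>+t. ennreal (2 powr (p * Suc k)) * ennreal ((cmod (d k t) * \<omega> t) powr p) \<partial>\<mu>)"
      unfolding H_def * by (rule nn_integral_suminf) measurable
    also have "\<dots> = ?B"
      unfolding modular_def cmod_weight by (intro suminf_cong nn_integral_cmult) measurable
    finally show ?thesis .
  qed
  then have "AE t in \<mu>. H t \<noteq> \<infinity>"
    using fin by (intro nn_integral_PInf_AE) auto
  then have AE: "AE t in \<mu>. summable (\<lambda>k. d k t) \<and>
      ennreal (cmod ((\<Sum>k. d k t) * complex_of_real (\<omega> t)) powr p) \<le> H t"
  proof eventually_elim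
    case (elim t)
    then have "H t < \<infinity>" by (simp add: less_top)
    note * = summable_and_bound_of_weighted_powr[OF p_pos this[unfolded H_def], folded H_def]
    have s: "summable (\<lambda>k. d k t)"
      using summable_mult2[OF *(1), of "inverse (complex_of_real (\<omega> t))"] weight_pos[of t]
      by (simp add: mult.assoc)
    then show ?case
      using *(2) suminf_mult2[OF s, of "complex_of_real (\<omega> t)"] by simp
  qed
  then show "AE t in \<mu>. summable (\<lambda>k. d k t)" by eventually_elim simp
  have "modular (\<lambda>t. \<Sum>k. d k t) \<le> integral\<^sup>N \<mu> H"
    unfolding modular_def by (rule nn_integral_mono_AE) (use AE in eventually_elim, simp)
  then show "modular (\<lambda>t. \<Sum>k. d k t) \<le> ?B"
    by (simp only: H)
qed

text \<open>
  Completeness, with quantitative control. The numbers \<open>M n\<close> will bound the translations chosen up to stage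
  \<open>n\<close>; as they increase, the steps after stage \<open>n\<close> are small even when multiplied by \<open>M n\<close>, so that their
  sum remains small after any of those translations has been applied.
\<close>

lemma rapidly_convergent_limit:
  assumes f: "\<And>n. f n \<in> borel_measurable borel" and M: "incseq M" "\<And>n. 1 \<le> M n"
    and close: "\<And>n. modular (\<lambda>t. f (Suc n) t - f n t) < ennreal ((1/2)^n / (M n * 2 powr (p * Suc n)))"
  obtains \<phi> where "\<phi> \<in> borel_measurable borel"
    "\<And>n. ennreal (M n) * modular (\<lambda>t. \<phi> t - f n t) \<le> ennreal (2 * (1/2)^n)"
proof -
  define d where "d = (\<lambda>n t. f (Suc n) t - f n t)"
  have [measurable]: "f n \<in> borel_measurable borel" for n by (rule f)
  have dm [measurable]: "d n \<in> borel_measurable borel" for n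
    unfolding d_def by measurable
  define \<phi> where "\<phi> t = f 0 t + (\<Sum>k. d k t)" for t
  have d_le: "ennreal (M n) * (ennreal (2 powr (p * Suc k)) * modular (d (k + n))) \<le> ennreal ((1/2)^(k + n))" for n k
  proof -
    define x where "x = (1/2)^(k + n) / (M (k + n) * 2 powr (p * Suc (k + n)))"
    have Mp: "0 < M (k + n)" "0 \<le> M n" using M(2)[of n] M(2)[of "k + n"] by auto
    have x: "0 \<le> x" using Mp by (simp add: x_def)
    have "modular (d (k + n)) \<le> ennreal x"
      using close[of "k + n"] unfolding d_def x_def by (rule less_imp_le)
    then have "ennreal (M n) * (ennreal (2 powr (p * Suc k)) * modular (d (k + n))) \<le>
        ennreal (M n) * (ennreal (2 powr (p * Suc k)) * ennreal x)"
      by (intro mult_left_mono) auto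
    also have "\<dots> = ennreal (M n * 2 powr (p * Suc k) * x)"
      using Mp x by (simp add: mult.assoc flip: ennreal_mult)
    also have "\<dots> \<le> ennreal (M (k + n) * 2 powr (p * Suc (k + n)) * x)"
      using incseqD[OF M(1), of n "k + n"] p_pos Mp x
      by (intro ennreal_leI mult_right_mono mult_mono powr_mono mult_left_mono) auto
    also have "M (k + n) * 2 powr (p * Suc (k + n)) * x = (1/2)^(k + n)"
      using Mp by (simp add: x_def)
    finally show ?thesis .
  qed
  have B: "ennreal (M n) * (\<Sum>k. ennreal (2 powr (p * Suc k)) * modular (d (k + n))) \<le> ennreal (2 * (1/2)^n)" for n
  proof -
    have "(\<lambda>k. (1/2)^n * (1/2)^k) sums ((1/2)^n * (1 / (1 - 1/2)) :: real)"
      by (intro sums_mult geometric_sums) auto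
    then have geo: "(\<lambda>k. (1/2)^(k + n)) sums (2 * (1/2)^n :: real)"
      by (simp add: power_add mult.commute)
    have "ennreal (M n) * (\<Sum>k. ennreal (2 powr (p * Suc k)) * modular (d (k + n))) \<le> (\<Sum>k. ennreal ((1/2)^(k + n)))"
      unfolding ennreal_suminf_cmult[symmetric] by (intro suminf_le summableI d_le)
    also have "\<dots> = ennreal (2 * (1/2)^n)"
      using geo by (intro suminf_ennreal_eq) auto
    finally show ?thesis .
  qed
  have fin: "(\<Sum>k. ennreal (2 powr (p * Suc k)) * modular (d (k + n))) < \<infinity>" for n
  proof -
    have "(\<Sum>k. ennreal (2 powr (p * Suc k)) * modular (d (k + n))) \<le>
      ennreal (M n) * (\<Sum>k. ennreal (2 powr (p * Suc k)) * modular (d (k + n)))"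
      using mult_right_mono[of 1 "ennreal (M n)"] M(2)[of n] by simp
    also note B
    also have "ennreal (2 * (1/2)^n) < \<infinity>" by simp
    finally show ?thesis .
  qed
  have "AE t in \<mu>. summable (\<lambda>k. d k t)"
    using modular_suminf_le(1)[OF dm, of "\<lambda>k. k"] fin[of 0] by simp
  then have tail: "AE t in \<mu>. cmod (\<phi> t - f n t) = cmod (\<Sum>k. d (k + n) t)" for n
  proof eventually_elim
    case (elim t)
    have "(\<Sum>k<n. d k t) = f n t - f 0 t"
      unfolding d_def by (rule sum_lessThan_telescope)
    then show ?case
      using suminf_split_initial_segment[OF elim, of n] by (simp add: \<phi>_def)
  qed
  show ?thesis
  proof (rule that)
    show "\<phi> \<in> borel_measurable borel" unfolding \<phi>_def by measurable
    fix n
    have "modular (\<lambda>t. \<phi> t - f n t) = modular (\<lambda>t. \<Sum>k. d (k + n) t)"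
      by (rule modular_cong_AE[OF tail])
    also have "\<dots> \<le> (\<Sum>k. ennreal (2 powr (p * Suc k)) * modular (d (k + n)))"
      by (rule modular_suminf_le(2)[OF dm fin])
    finally show "ennreal (M n) * modular (\<lambda>t. \<phi> t - f n t) \<le> ennreal (2 * (1/2)^n)"
      using B[of n] by (meson mult_left_mono order_trans zero_le)
  qed
qed

text \<open>
  Baire's argument carried out by hand. Stage \<open>n\<close> changes the current test function by a tiny amount so that
  some translation \<open>s n\<close> takes it near \<open>G n\<close>. The size of a step is limited by the norms of all earlier
  translations, so \<open>T\<^bsub>s n\<^esub>\<close> takes the limit near \<open>G n\<close> as well. The sequence \<open>G\<close> repeats every member of the
  countable dense family infinitely often, because a given target must be met at stages with arbitrarily
  small error.
\<close>

lemma dense_vector_of_Lp_condition: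
  assumes adm: "admissible_weight \<mu> S \<omega>" and Lp: "Lp_condition \<mu> S \<omega> p"
  shows "\<exists>f. dense_vector \<mu> S \<omega> p f"
proof -
  obtain g :: "nat \<Rightarrow> 'a \<Rightarrow> complex" where g: "\<And>n. test_function (g n)"
    "\<And>h \<epsilon>. h \<in> borel_measurable borel \<Longrightarrow> modular h < \<infinity> \<Longrightarrow> 0 < \<epsilon> \<Longrightarrow>
       \<exists>n. modular (\<lambda>t. h t - g n t) < ennreal \<epsilon>"
    using countable_dense_test_functions by blast
  define G where "G n = g (fst (prod_decode n))" for n
  \<comment> \<open>A state is a test function with the bound for the translations so far. The start at \<open>0\<close> makes the
      first tail estimate a bound on the modular of the limit itself.\<close>
  define P where "P n x \<longleftrightarrow> test_function (fst x) \<and> 1 \<le> snd x \<and> (n = 0 \<longrightarrow> fst x = (\<lambda>t. 0))"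
    for n :: nat and x :: "('a \<Rightarrow> complex) \<times> real"
  define Q where "Q n x y \<longleftrightarrow> snd x \<le> snd y \<and>
      modular (\<lambda>t. fst y t - fst x t) < ennreal ((1/2)^n / (snd x * 2 powr (p * Suc n))) \<and>
      (\<exists>s\<in>S. modular (\<lambda>t. translation s (fst y) t - G n t) < ennreal ((1/2)^n) \<and>
        (\<forall>h\<in>borel_measurable borel. modular (translation s h) \<le> ennreal (snd y) * modular h))"
    for n and x y :: "('a \<Rightarrow> complex) \<times> real"
  have "\<exists>x. \<forall>n. P n (x n) \<and> Q n (x n) (x (Suc n))"
  proof (rule dependent_nat_choice)
    have "test_function (\<lambda>t. 0)"
      unfolding test_function_def by (auto intro: exI[of _ 0] exI[of _ "{}"])
    then show "\<exists>x. P 0 x"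
      by (intro exI[of _ "(\<lambda>t. 0, 1)"]) (simp add: P_def)
  next
    fix x n assume x: "P n x"
    define \<epsilon> where "\<epsilon> = (1/2)^n / (snd x * 2 powr (p * Suc n))"
    have Mx: "1 \<le> snd x" using x by (simp add: P_def)
    have pow: "(1::real) \<le> 2 powr (p * Suc n)"
      using p_pos by (intro ge_one_powr_ge_zero) auto
    have prod: "1 \<le> snd x * 2 powr (p * Suc n)"
      using mult_mono[OF Mx pow] Mx by simp
    have \<epsilon>: "0 < \<epsilon>" "\<epsilon> \<le> (1/2)^n"
      unfolding \<epsilon>_def using prod by (auto simp: divide_le_eq)
    obtain s f' where s: "s \<in> S" and f': "test_function f'"
      "modular (\<lambda>t. f' t - fst x t) < ennreal \<epsilon>" "modular (\<lambda>t. translation s f' t - G n t) < ennreal \<epsilon>"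
      using topologically_transitive[OF Lp _ g(1) \<epsilon>(1)] x unfolding P_def G_def by blast
    obtain C where C: "1 \<le> C"
      "\<And>h. h \<in> borel_measurable borel \<Longrightarrow> modular (translation s h) \<le> ennreal C * modular h"
      using translation_bound[OF adm s] by blast
    have "modular (translation s h) \<le> ennreal (max (snd x) C) * modular h"
      if "h \<in> borel_measurable borel" for h
      using C(2)[OF that] by (rule order_trans) (intro mult_right_mono ennreal_leI; simp)
    moreover have "modular (\<lambda>t. translation s f' t - G n t) < ennreal ((1/2)^n)"
      using f'(3) \<epsilon>(2) by (meson ennreal_leI order_less_le_trans)
    ultimately have "Q n x (f', max (snd x) C)"
      using s f'(2) unfolding Q_def \<epsilon>_def by auto
    moreover have "P (Suc n) (f', max (snd x) C)"
      using f'(1) Mx by (auto simp: P_def)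
    ultimately show "\<exists>y. P (Suc n) y \<and> Q n x y" by blast
  qed
  then obtain x where x: "\<And>n. P n (x n)" "\<And>n. Q n (x n) (x (Suc n))" by blast
  define f where "f n = fst (x n)" for n
  define M where "M n = snd (x n)" for n
  have test: "test_function (f n)" and M1: "1 \<le> M n" for n
    using x(1)[of n] by (auto simp: P_def f_def M_def)
  have f0: "f 0 = (\<lambda>t. 0)" using x(1)[of 0] by (simp add: P_def f_def)
  have fm [measurable]: "f n \<in> borel_measurable borel" for n
    by (rule test_function_measurable[OF test])
  have Gm [measurable]: "G n \<in> borel_measurable borel" for n
    unfolding G_def by (rule test_function_measurable[OF g(1)])
  have incM: "incseq M"
    using x(2) by (intro incseq_SucI) (simp add: Q_def M_def)
  have close: "modular (\<lambda>t. f (Suc n) t - f n t) < ennreal ((1/2)^n / (M n * 2 powr (p * Suc n)))" for n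
    using x(2)[of n] by (simp add: Q_def f_def M_def)
  have "\<exists>s. s \<in> S \<and> modular (\<lambda>t. translation s (f (Suc n)) t - G n t) < ennreal ((1/2)^n) \<and>
        (\<forall>h\<in>borel_measurable borel. modular (translation s h) \<le> ennreal (M (Suc n)) * modular h)" for n
    using x(2)[of n] unfolding Q_def f_def M_def by blast
  then obtain s where s: "\<And>n. s n \<in> S"
    "\<And>n. modular (\<lambda>t. translation (s n) (f (Suc n)) t - G n t) < ennreal ((1/2)^n)"
    "\<And>n h. h \<in> borel_measurable borel \<Longrightarrow> modular (translation (s n) h) \<le> ennreal (M (Suc n)) * modular h"
    by metis
  obtain \<phi> where \<phi> [measurable]: "\<phi> \<in> borel_measurable borel"
    and \<phi>_close: "\<And>n. ennreal (M n) * modular (\<lambda>t. \<phi> t - f n t) \<le> ennreal (2 * (1/2)^n)"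
    using rapidly_convergent_limit[OF fm incM M1 close] by blast
  have hit: "modular (\<lambda>t. translation (s n) \<phi> t - G n t) \<le> ennreal (2 powr p * (2 * (1/2)^n))" for n
  proof -
    have eq: "(\<lambda>t. translation (s n) \<phi> t - G n t) = (\<lambda>t. translation (s n) (\<lambda>t. \<phi> t - f (Suc n) t) t
        + (translation (s n) (f (Suc n)) t - G n t))"
      by (simp add: translation_def)
    have "modular (\<lambda>t. translation (s n) \<phi> t - G n t) \<le> ennreal (2 powr p) *
        (modular (translation (s n) (\<lambda>t. \<phi> t - f (Suc n) t)) + modular (\<lambda>t. translation (s n) (f (Suc n)) t - G n t))"
      unfolding eq
      by (intro modular_add_le borel_measurable_diff measurable_translation \<phi> fm Gm)
    also have "modular (translation (s n) (\<lambda>t. \<phi> t - f (Suc n) t)) \<le> ennreal ((1/2)^n)"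
      using s(3)[of "\<lambda>t. \<phi> t - f (Suc n) t" n] \<phi>_close[of "Suc n"] by (auto intro: order_trans)
    also have "modular (\<lambda>t. translation (s n) (f (Suc n)) t - G n t) \<le> ennreal ((1/2)^n)"
      using s(2)[of n] by simp
    also have "ennreal (2 powr p) * (ennreal ((1/2)^n) + ennreal ((1/2)^n)) = ennreal (2 powr p * (2 * (1/2)^n))"
      by (simp flip: ennreal_plus ennreal_mult)
    finally show ?thesis by (simp add: mult_left_mono add_mono)
  qed
  have "dense_vector \<mu> S \<omega> p \<phi>"
    unfolding dense_vector_iff
  proof (intro conjI ballI allI impI \<phi>)
    have "modular \<phi> = 1 * modular (\<lambda>t. \<phi> t - f 0 t)" by (simp add: f0)
    also have "\<dots> \<le> ennreal (M 0) * modular (\<lambda>t. \<phi> t - f 0 t)"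
      using M1[of 0] by (intro mult_right_mono) auto
    also note \<phi>_close
    also have "ennreal (2 * (1/2)^0) < \<infinity>" by simp
    finally show "modular \<phi> < \<infinity>" .
    fix h \<epsilon> assume h [measurable]: "h \<in> borel_measurable borel" and fin: "modular h < \<infinity>" and "0 < (\<epsilon>::real)"
    define e where "e = \<epsilon> / 2 / 2 powr p"
    have e: "0 < e" using \<open>0 < \<epsilon>\<close> by (simp add: e_def)
    obtain i where i: "modular (\<lambda>t. h t - g i t) < ennreal e"
      using g(2)[OF h fin e] by blast
    have "(\<lambda>n. 2 powr p * (2 * (1/2)^n)) \<longlonglongrightarrow> 2 powr p * (2 * 0)"
      by (intro tendsto_intros LIMSEQ_power_zero) auto
    then have "eventually (\<lambda>n. 2 powr p * (2 * (1/2)^n) < e) sequentially"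
      using e by (intro order_tendstoD(2)) auto
    then obtain m where m: "\<And>n. m \<le> n \<Longrightarrow> 2 powr p * (2 * (1/2)^n) < e"
      by (auto simp: eventually_sequentially)
    define n where "n = prod_encode (i, m)"
    have "m \<le> n" unfolding n_def by (rule le_prod_encode_2)
    have "modular (\<lambda>t. translation (s n) \<phi> t - G n t) < ennreal e"
      using hit[of n] m[OF \<open>m \<le> n\<close>] by (meson ennreal_lessI e order_le_less_trans)
    moreover have "modular (\<lambda>t. G n t - h t) < ennreal e"
      using i modular_uminus[of "\<lambda>t. h t - g i t"] by (simp add: G_def n_def)
    ultimately have "modular (\<lambda>t. (translation (s n) \<phi> t - G n t) + (G n t - h t)) < ennreal \<epsilon>"
      using \<open>0 < \<epsilon>\<close> unfolding e_def
      by (intro modular_add_less borel_measurable_diff measurable_translation \<phi> Gm h)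
    then show "\<exists>s\<in>S. modular (\<lambda>t. translation s \<phi> t - h t) < ennreal \<epsilon>"
      using s(1) by auto
  qed
  then show ?thesis by blast
qed

end

theorem theorem10:
  fixes \<mu> :: "'a::{topological_group_add, second_countable_topology, t2_space} measure"
    and S :: "'a set"
    and \<omega> :: "'a \<Rightarrow> real"
  assumes "locally compact (UNIV :: 'a set)"
    and "\<not> compact (UNIV :: 'a set)"
    and "left_haar_measure \<mu>"
    and "generates_abelian_subgroup S"
    and "admissible_weight \<mu> S \<omega>"
  shows "((\<forall>p\<ge>1. \<exists>f. dense_vector \<mu> S \<omega> p f) \<longleftrightarrow> (\<exists>p\<ge>1. \<exists>f. dense_vector \<mu> S \<omega> p f)) \<and>
         ((\<exists>p\<ge>1. \<exists>f. dense_vector \<mu> S \<omega> p f) \<longleftrightarrow> esssup_condition \<mu> S \<omega>) \<and>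
         (esssup_condition \<mu> S \<omega> \<longleftrightarrow> (\<exists>p\<ge>1. Lp_condition \<mu> S \<omega> p)) \<and>
         ((\<exists>p\<ge>1. Lp_condition \<mu> S \<omega> p) \<longleftrightarrow> (\<forall>p\<ge>1. Lp_condition \<mu> S \<omega> p))"
proof -
  have group: "weighted_haar_group \<mu> \<omega> p" if "1 \<le> p" for p
    using assms that by unfold_locales (auto simp: admissible_weight_def)
  have Lp: "Lp_condition \<mu> S \<omega> p \<longleftrightarrow> esssup_condition \<mu> S \<omega>" if "1 \<le> p" for p
    using weighted_haar_group.esssup_condition_imp_Lp_condition[OF group[OF that]]
      weighted_haar_group.Lp_condition_imp_esssup_condition[OF group[OF that]] by blast
  have dense: "(\<exists>f. dense_vector \<mu> S \<omega> p f) \<longleftrightarrow> Lp_condition \<mu> S \<omega> p" if "1 \<le> p" for p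
    using weighted_haar_group.dense_vector_imp_Lp_condition[OF group[OF that] assms(5,4)]
      weighted_haar_group.dense_vector_of_Lp_condition[OF group[OF that] assms(5)] by blast
  have "(1::real) \<le> 1" by simp
  with Lp dense show ?thesis by metis
qed

end
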